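(* Let $(M,F)$ and $(N,\widetilde F)$ be Finsler manifolds and let $\varphi:M\to N$ be a nondegenerate smooth map. Then $\varphi$ is an affine map between the Finsler manifolds $(M,F)$ and $(N,\widetilde F)$ if and only if $\varphi$ carries autoparallel curves of $(M,F)$ into autoparallel curves of $(N,\widetilde F)$, i.e. for every autoparallel curve $c$ on $(M,F)$ the curve $\varphi\circ c$ is an autoparallel curve on $(N,\widetilde F)$.
   Context: Einstein summation is used. A Finsler manifold $(M,F)$ is a smooth $p$-dimensional manifold $M$ with $F:TM\to[0,\infty)$ smooth on $TM\setminus\{0\}$, positively 1-homogeneous on fibres, such that $g_{\alpha\beta}=\frac12\frac{\partial^2F^2}{\partial s^\alpha\partial s^\beta}$ is positive definite on $TM\setminus\{0\}$; $(t^\alpha,s^\alpha)$, $\alpha=1,\dots,p$, are the induced coordinates on $TM$. Put $\gamma^\mu_{\alpha\beta}=\frac{g^{\mu\varepsilon}}2\left(\frac{\partial g_{\varepsilon\alpha}}{\partial t^\beta}+\frac{\partial g_{\varepsilon\beta}}{\partial t^\alpha}-\frac{\partial g_{\alpha\beta}}{\partial t^\varepsilon}\right)$, $G^\mu=\frac12\gamma^\mu_{\alpha\beta}s^\alpha s^\beta$ (spray coefficients), $N^\gamma_\alpha=\frac{\partial G^\gamma}{\partial s^\alpha}$ (nonlinear Cartan connection), $B^\gamma_{\alpha\beta}=\frac{\partial^2G^\gamma}{\partial s^\alpha\partial s^\beta}$ (components of the Berwald connection), all functions on $TM\setminus\{0\}$. The corresponding objects of $(N,\widetilde F)$, $\dim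 N=n$, with coordinates $(x^i,y^i)$ on $TN$, are denoted with tildes and Latin indices $i,j,k=1,\dots,n$. A curve $c:[a,b]\to M$, $t^\alpha=t^\alpha(t)$, is an autoparallel curve on $(M,F)$ if $\frac{d^2t^\alpha}{dt^2}+N^\alpha_\beta\left(t^\mu(t),\frac{dt^\mu}{dt}\right)\frac{dt^\beta}{dt}=0$ for all $\alpha$ (equivalently $\frac{d^2t^\alpha}{dt^2}+2G^\alpha(t^\mu(t),\frac{dt^\mu}{dt})=0$). A smooth map $\varphi:M\to N$ is nondegenerate if $\ker(d\varphi)=\{0\}$ at every point. Write $\varphi^i_\alpha=\frac{\partial\varphi^i}{\partial t^\alpha}$, $\varphi^i_{\alpha\beta}=\frac{\partial^2\varphi^i}{\partial t^\alpha\partial t^\beta}$. A nondegenerate smooth map $\varphi$ is an affine map between $(M,F)$ and $(N,\widetilde F)$ if for all $\alpha,\beta,i$ and all $(t,s)\in TM\setminus\{0\}$: $\varphi^i_{\alpha\beta}-B^\gamma_{\alpha\beta}\varphi^i_\gamma+\widetilde B^i_{jk}\varphi^j_\alpha\varphi^k_\beta=0$, where $B^\gamma_{\alpha\beta}=B^\gamma_{\alpha\beta}(t^\mu,s^\mu)$ and $\widetilde B^i_{jk}=\widetilde B^i_{jk}(\varphi^l(t),\varphi^l_\varepsilon(t)s^\varepsilon)$. *)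

theory Defs
  imports "HOL-Analysis.Analysis"
begin

section \<open>Smooth functions on open subsets of Euclidean spaces\<close>

text \<open>All sets \<open>S\<close> used below are open, so the unrestricted derivative at a point of \<open>S\<close>
  only sees the values of the function on \<open>S\<close>.\<close>

primrec C_k_on :: "nat \<Rightarrow> ('a::euclidean_space \<Rightarrow> 'b::euclidean_space) \<Rightarrow> 'a set \<Rightarrow> bool" where
  "C_k_on 0 f S \<longleftrightarrow> continuous_on S f"
| "C_k_on (Suc k) f S \<longleftrightarrow>
     (\<forall>x\<in>S. f differentiable (at x)) \<and> (\<forall>v. C_k_on k (\<lambda>x. frechet_derivative f (at x) v) S)"

definition smooth_on :: "'a::euclidean_space set \<Rightarrow> ('a \<Rightarrow> 'b::euclidean_space) \<Rightarrow> bool" where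
  "smooth_on S f \<longleftrightarrow> (\<forall>k. C_k_on k f S)"


section \<open>Smooth manifolds\<close>

text \<open>A chart is a coordinate domain together with its coordinate map; the dimension is the
  cardinality of the finite index type \<open>'p\<close>.\<close>

type_synonym ('a, 'p) chart = "'a set \<times> ('a \<Rightarrow> real ^ 'p)"

abbreviation domain :: "('a, 'p::finite) chart \<Rightarrow> 'a set" where
  "domain c \<equiv> fst c"

abbreviation coord :: "('a, 'p::finite) chart \<Rightarrow> 'a \<Rightarrow> real ^ 'p" where
  "coord c \<equiv> snd c"

definition point_of :: "('a, 'p::finite) chart \<Rightarrow> real ^ 'p \<Rightarrow> 'a" where
  "point_of c = inv_into (domain c) (coord c)"

definition local_rep ::
  "('a, 'p::finite) chart \<Rightarrow> ('b, 'n::finite) chart \<Rightarrow> ('a \<Rightarrow> 'b) \<Rightarrow> real ^ 'p \<Rightarrow> real ^ 'n" where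
  "local_rep c d f = coord d \<circ> f \<circ> point_of c"

abbreviation transition :: "('a, 'p::finite) chart \<Rightarrow> ('a, 'p) chart \<Rightarrow> real ^ 'p \<Rightarrow> real ^ 'p" where
  "transition c d \<equiv> local_rep c d id"

definition is_chart :: "'a topology \<Rightarrow> ('a, 'p::finite) chart \<Rightarrow> bool" where
  "is_chart X c \<longleftrightarrow>
     openin X (domain c) \<and> open (coord c ` domain c) \<and>
     homeomorphic_map (subtopology X (domain c)) (top_of_set (coord c ` domain c)) (coord c)"

text \<open>The atlas is not required to be maximal.\<close>

definition smooth_manifold :: "'a topology \<Rightarrow> ('a, 'p::finite) chart set \<Rightarrow> bool" where
  "smooth_manifold X A \<longleftrightarrow>
     Hausdorff_space X \<and> second_countable X \<and>
     (\<forall>c\<in>A. is_chart X c) \<and> (\<Union>c\<in>A. domain c) = topspace X \<and>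
     (\<forall>c\<in>A. \<forall>d\<in>A. smooth_on (coord c ` (domain c \<inter> domain d)) (transition c d))"

definition smooth_map ::
  "'a topology \<Rightarrow> ('a, 'p::finite) chart set \<Rightarrow> 'b topology \<Rightarrow> ('b, 'n::finite) chart set \<Rightarrow>
   ('a \<Rightarrow> 'b) \<Rightarrow> bool" where
  "smooth_map X A Y B \<phi> \<longleftrightarrow>
     continuous_map X Y \<phi> \<and>
     (\<forall>c\<in>A. \<forall>d\<in>B. smooth_on (coord c ` (domain c \<inter> \<phi> -` domain d)) (local_rep c d \<phi>))"


section \<open>Tangent spaces and differentials\<close>

text \<open>A tangent vector at \<open>x\<close> is the family of its coordinate vectors in all charts of the atlas
  around \<open>x\<close>, related by the derivatives of the transition maps, and \<open>0\<close> at all other arguments.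
  Hence the vector space operations are the pointwise ones.\<close>

type_synonym ('a, 'p) tvec = "('a, 'p) chart \<Rightarrow> real ^ 'p"

definition tangent_space ::
  "('a, 'p::finite) chart set \<Rightarrow> 'a \<Rightarrow> ('a, 'p) tvec set" where
  "tangent_space A x =
     {v. (\<forall>c. \<not> (c \<in> A \<and> x \<in> domain c) \<longrightarrow> v c = 0) \<and>
         (\<forall>c\<in>A. \<forall>d\<in>A. x \<in> domain c \<and> x \<in> domain d \<longrightarrow>
            v d = frechet_derivative (transition c d) (at (coord c x)) (v c))}"

text \<open>The tangent vector at \<open>x\<close> whose coordinate vector in the chart \<open>c\<close> is \<open>s\<close>.\<close>

definition tvec_of ::
  "('a, 'p::finite) chart set \<Rightarrow> 'a \<Rightarrow> ('a, 'p) chart \<Rightarrow> real ^ 'p \<Rightarrow> ('a, 'p) tvec" where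
  "tvec_of A x c s =
     (\<lambda>d. if d \<in> A \<and> x \<in> domain d
          then frechet_derivative (transition c d) (at (coord c x)) s else 0)"

text \<open>The choice of the chart \<open>c\<close> at \<open>x\<close> is immaterial by the chain rule.\<close>

definition differential ::
  "('a, 'p::finite) chart set \<Rightarrow> ('b, 'n::finite) chart set \<Rightarrow> ('a \<Rightarrow> 'b) \<Rightarrow> 'a \<Rightarrow>
   ('a, 'p) tvec \<Rightarrow> ('b, 'n) tvec" where
  "differential A B \<phi> x v =
     (let c = (SOME c. c \<in> A \<and> x \<in> domain c)
      in (\<lambda>d. if d \<in> B \<and> \<phi> x \<in> domain d
             then frechet_derivative (local_rep c d \<phi>) (at (coord c x)) (v c) else 0))"

definition nondegenerate ::
  "'a topology \<Rightarrow> ('a, 'p::finite) chart set \<Rightarrow> ('b, 'n::finite) chart set \<Rightarrow> ('a \<Rightarrow> 'b) \<Rightarrow> bool" where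
  "nondegenerate X A B \<phi> \<longleftrightarrow>
     (\<forall>x\<in>topspace X. {v \<in> tangent_space A x. differential A B \<phi> x v = (\<lambda>d. 0)} = {\<lambda>c. 0})"


section \<open>Finsler manifolds\<close>

text \<open>Functions on the tangent bundle are written in the induced coordinates \<open>(t, s)\<close>.
  \<open>partial_t \<alpha>\<close> and \<open>partial_s \<alpha>\<close> are the partial derivatives with respect to the \<open>\<alpha>\<close>-th
  component of \<open>t\<close> and of \<open>s\<close>.\<close>

type_synonym 'p phase_fun = "(real ^ 'p) \<times> (real ^ 'p) \<Rightarrow> real"

definition partial_t :: "'p \<Rightarrow> 'p::finite phase_fun \<Rightarrow> 'p phase_fun" where
  "partial_t \<alpha> f = (\<lambda>z. frechet_derivative f (at z) (axis \<alpha> 1, 0))"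

definition partial_s :: "'p \<Rightarrow> 'p::finite phase_fun \<Rightarrow> 'p phase_fun" where
  "partial_s \<alpha> f = (\<lambda>z. frechet_derivative f (at z) (0, axis \<alpha> 1))"

text \<open>A function on the tangent bundle takes a base point and a tangent vector at that point.\<close>

definition in_coords ::
  "('a, 'p::finite) chart set \<Rightarrow> ('a \<Rightarrow> ('a, 'p) tvec \<Rightarrow> real) \<Rightarrow> ('a, 'p) chart \<Rightarrow> 'p phase_fun" where
  "in_coords A F c = (\<lambda>(t, s). F (point_of c t) (tvec_of A (point_of c t) c s))"

text \<open>Below, \<open>L\<close> is the Finsler function in the induced coordinates of a chart.\<close>

definition metric :: "'p::finite phase_fun \<Rightarrow> 'p \<Rightarrow> 'p \<Rightarrow> 'p phase_fun" where
  "metric L \<alpha> \<beta> = (\<lambda>z. 1/2 * partial_s \<alpha> (partial_s \<beta> (\<lambda>z. (L z)\<^sup>2)) z)"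

definition metric_inv :: "'p::finite phase_fun \<Rightarrow> 'p \<Rightarrow> 'p \<Rightarrow> 'p phase_fun" where
  "metric_inv L \<alpha> \<beta> = (\<lambda>z. matrix_inv (\<chi> \<mu> \<nu>. metric L \<mu> \<nu> z) $ \<alpha> $ \<beta>)"

definition christoffel :: "'p::finite phase_fun \<Rightarrow> 'p \<Rightarrow> 'p \<Rightarrow> 'p \<Rightarrow> 'p phase_fun" where
  "christoffel L \<mu> \<alpha> \<beta> =
     (\<lambda>z. \<Sum>\<epsilon>\<in>UNIV. metric_inv L \<mu> \<epsilon> z / 2 *
            (partial_t \<beta> (metric L \<epsilon> \<alpha>) z + partial_t \<alpha> (metric L \<epsilon> \<beta>) z
             - partial_t \<epsilon> (metric L \<alpha> \<beta>) z))"

definition spray :: "'p::finite phase_fun \<Rightarrow> 'p \<Rightarrow> 'p phase_fun" where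
  "spray L \<mu> =
     (\<lambda>(t, s). 1/2 * (\<Sum>\<alpha>\<in>UNIV. \<Sum>\<beta>\<in>UNIV. christoffel L \<mu> \<alpha> \<beta> (t, s) * s $ \<alpha> * s $ \<beta>))"

definition nonlinear_connection :: "'p::finite phase_fun \<Rightarrow> 'p \<Rightarrow> 'p \<Rightarrow> 'p phase_fun" where
  "nonlinear_connection L \<gamma> \<alpha> = partial_s \<alpha> (spray L \<gamma>)"

definition berwald :: "'p::finite phase_fun \<Rightarrow> 'p \<Rightarrow> 'p \<Rightarrow> 'p \<Rightarrow> 'p phase_fun" where
  "berwald L \<gamma> \<alpha> \<beta> = partial_s \<alpha> (partial_s \<beta> (spray L \<gamma>))"

definition finsler_manifold ::
  "'a topology \<Rightarrow> ('a, 'p::finite) chart set \<Rightarrow> ('a \<Rightarrow> ('a, 'p) tvec \<Rightarrow> real) \<Rightarrow> bool" where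
  "finsler_manifold X A F \<longleftrightarrow>
     smooth_manifold X A \<and>
     (\<forall>x\<in>topspace X. \<forall>v\<in>tangent_space A x. F x v \<ge> 0) \<and>
     (\<forall>x\<in>topspace X. \<forall>v\<in>tangent_space A x. \<forall>r>0. F x (\<lambda>c. r *\<^sub>R v c) = r * F x v) \<and>
     (\<forall>c\<in>A. smooth_on (coord c ` domain c \<times> (UNIV - {0})) (in_coords A F c)) \<and>
     (\<forall>c\<in>A. \<forall>t\<in>coord c ` domain c. \<forall>s. s \<noteq> 0 \<longrightarrow>
        (\<forall>w. w \<noteq> 0 \<longrightarrow>
           (\<Sum>\<alpha>\<in>UNIV. \<Sum>\<beta>\<in>UNIV. metric (in_coords A F c) \<alpha> \<beta> (t, s) * w $ \<alpha> * w $ \<beta>) > 0))"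


section \<open>Autoparallel curves and affine maps\<close>

text \<open>The nonlinear connection lives on nonzero tangent vectors only, so the velocity of an
  autoparallel curve is nowhere zero.  At the end points of the interval derivatives are one-sided.
  In a chart \<open>c\<close>, the curve \<open>coord c \<circ> k\<close> is only meaningful at parameters \<open>\<tau>\<close> with
  \<open>k \<tau> \<in> domain c\<close>; these form a relatively open subset of the interval, so derivatives at
  such \<open>\<tau>\<close> do not depend on the values elsewhere.\<close>

definition velocity :: "real \<Rightarrow> real \<Rightarrow> (real \<Rightarrow> real ^ 'p::finite) \<Rightarrow> real \<Rightarrow> real ^ 'p" where
  "velocity a b x = (\<lambda>\<tau>. vector_derivative x (at \<tau> within {a..b}))"

definition autoparallel ::
  "'a topology \<Rightarrow> ('a, 'p::finite) chart set \<Rightarrow> ('a \<Rightarrow> ('a, 'p) tvec \<Rightarrow> real) \<Rightarrow>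
   real \<Rightarrow> real \<Rightarrow> (real \<Rightarrow> 'a) \<Rightarrow> bool" where
  "autoparallel X A F a b k \<longleftrightarrow>
     a < b \<and> continuous_map (top_of_set {a..b}) X k \<and>
     (\<forall>c\<in>A. \<forall>\<tau>\<in>{a..b}. k \<tau> \<in> domain c \<longrightarrow>
        (let x = coord c \<circ> k; x' = velocity a b x; x'' = velocity a b x'
         in x differentiable (at \<tau> within {a..b}) \<and>
            x' differentiable (at \<tau> within {a..b}) \<and>
            x' \<tau> \<noteq> 0 \<and>
            (\<forall>\<alpha>. x'' \<tau> $ \<alpha> +
                 (\<Sum>\<beta>\<in>UNIV. nonlinear_connection (in_coords A F c) \<alpha> \<beta> (x \<tau>, x' \<tau>) * x' \<tau> $ \<beta>) = 0)))"

definition partial1 :: "'p \<Rightarrow> (real ^ 'p::finite \<Rightarrow> real) \<Rightarrow> real ^ 'p \<Rightarrow> real" where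
  "partial1 \<alpha> f = (\<lambda>t. frechet_derivative f (at t) (axis \<alpha> 1))"

definition partial2 :: "'p \<Rightarrow> 'p \<Rightarrow> (real ^ 'p::finite \<Rightarrow> real) \<Rightarrow> real ^ 'p \<Rightarrow> real" where
  "partial2 \<alpha> \<beta> f = partial1 \<alpha> (partial1 \<beta> f)"

definition affine_map ::
  "('a, 'p::finite) chart set \<Rightarrow> ('a \<Rightarrow> ('a, 'p) tvec \<Rightarrow> real) \<Rightarrow>
   ('b, 'n::finite) chart set \<Rightarrow> ('b \<Rightarrow> ('b, 'n) tvec \<Rightarrow> real) \<Rightarrow> ('a \<Rightarrow> 'b) \<Rightarrow> bool" where
  "affine_map A F B F' \<phi> \<longleftrightarrow>
     (\<forall>c\<in>A. \<forall>d\<in>B. \<forall>t\<in>coord c ` (domain c \<inter> \<phi> -` domain d). \<forall>s. s \<noteq> 0 \<longrightarrow>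
        (let f = (\<lambda>i t. local_rep c d \<phi> t $ i);
             y = (\<chi> i. \<Sum>\<epsilon>\<in>UNIV. partial1 \<epsilon> (f i) t * s $ \<epsilon>)
         in \<forall>\<alpha> \<beta> i.
              partial2 \<alpha> \<beta> (f i) t
              - (\<Sum>\<gamma>\<in>UNIV. berwald (in_coords A F c) \<gamma> \<alpha> \<beta> (t, s) * partial1 \<gamma> (f i) t)
              + (\<Sum>j\<in>UNIV. \<Sum>k\<in>UNIV.
                   berwald (in_coords B F' d) i j k (local_rep c d \<phi> t, y)
                   * partial1 \<alpha> (f j) t * partial1 \<beta> (f k) t) = 0))"

end

theory Submission
  imports Defs
begin

text \<open>Write \<open>\<Delta>(v, w)\<close> for the left-hand side of the affine map equation at \<open>(t, s)\<close> contracted with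
  \<open>v\<close> and \<open>w\<close>.  Spray coefficients are 2-homogeneous in \<open>s\<close>, so by Euler's relation
  \<open>\<Delta>(s, s)\<close> contains the sprays themselves instead of their second derivatives, and it is exactly
  the autoparallel defect of the image of an autoparallel curve through \<open>t\<close> with velocity \<open>s\<close>.
  Conversely, if \<open>\<Delta>(s, s)\<close> vanishes for all \<open>s \<noteq> 0\<close>, differentiating it twice in \<open>s\<close> recovers
  \<open>\<Delta>(v, w) = 0\<close>.  That direction needs an autoparallel curve with given initial velocity, which
  the Picard theorem provides in one chart; it solves the equation in every other chart because the
  spray equation is the Euler--Lagrange equation of the squared Finsler function, a
  chart-independent condition.\<close>

section \<open>Calculus of smooth functions\<close>

text \<open>Two domains constrain the argument. Sprays are smooth only off the zero section, and
  nondegeneracy is what keeps the image velocity \<open>D f t s\<close> there. A coordinate curve is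
  meaningful only while its points lie in the chart, so derivatives along curves are taken on
  relatively open sets of parameters and are one-sided at end points.

  Recovering \<Delta> from its diagonal is not the polarization of a quadratic form, since the
  coefficients depend on \<open>s\<close> as well; what makes it possible is that the diagonal
  vanishes on the open set of all nonzero \<open>s\<close>, where it can be differentiated.

  The change of chart avoids the inhomogeneous transformation law of spray coefficients. The squared
  Finsler functions of two charts agree through the tangent map of the transition. Differentiating
  the resulting equality of fibre derivatives along the curve carries the Euler--Lagrange equation
  over, and positive definiteness of the metric turns it back into the spray equation.\<close>

abbreviation D where "D f x \<equiv> frechet_derivative f (at x)"
text \<open>The slots play different roles: \<open>v\<close> is the direction of the inner
  derivative, \<open>w\<close> that of the outer one. Linearity in \<open>w\<close> is immediate
  from differentiability, linearity in \<open>v\<close> is obtained through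
  \<open>symmetric_D2\<close>.\<close>

abbreviation D2 where "D2 f x v w \<equiv> frechet_derivative (\<lambda>y. frechet_derivative f (at y) v) (at x) w"

lemma has_derivative_D: "(f has_derivative f') (at x) \<Longrightarrow> D f x = f'"
  by (rule frechet_derivative_at[symmetric])

lemma differentiable_D: "f differentiable at x \<Longrightarrow> (f has_derivative D f x) (at x)"
  by (simp add: frechet_derivative_works)

text \<open>The candidate derivatives of \<open>f\<close> and \<open>g\<close> at \<open>x\<close>
  coincide, so the choice operator inside \<open>frechet_derivative\<close> picks the same map,
  whether or not a derivative exists.\<close>

lemma D_cong_open:
  assumes "open S" "x \<in> S" "\<And>y. y \<in> S \<Longrightarrow> f y = g y"
  shows "D f x = D g x"
proof -
  have "(f has_derivative h) (at x) \<longleftrightarrow> (g has_derivative h) (at x)" for h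
    using has_derivative_transform_within_open[OF _ assms(1,2)] assms(3) by metis
  then show ?thesis by (simp add: frechet_derivative_def)
qed

lemma differentiable_cong_open:
  assumes "open S" "x \<in> S" "\<And>y. y \<in> S \<Longrightarrow> f y = g y"
  shows "f differentiable at x \<longleftrightarrow> g differentiable at x"
  using has_derivative_transform_within_open[OF _ assms(1,2)] assms(3)
  unfolding differentiable_def by metis

lemma C_k_on_cong:
  assumes "open S" "\<And>y. y \<in> S \<Longrightarrow> f y = g y"
  shows "C_k_on k f S \<longleftrightarrow> C_k_on k g S"
  using assms(2)
proof (induction k arbitrary: f g)
  case 0
  then show ?case by (simp cong: continuous_on_cong)
next
  case (Suc k)
  have "C_k_on k (\<lambda>x. D f x v) S \<longleftrightarrow> C_k_on k (\<lambda>x. D g x v) S" for v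
    by (rule Suc.IH) (metis D_cong_open assms(1) Suc.prems)
  moreover have "\<forall>x\<in>S. f differentiable at x \<longleftrightarrow> g differentiable at x"
    using differentiable_cong_open[OF assms(1)] Suc.prems by blast
  ultimately show ?case by simp
qed

lemma smooth_on_cong:
  "open S \<Longrightarrow> (\<And>y. y \<in> S \<Longrightarrow> f y = g y) \<Longrightarrow> smooth_on S f \<longleftrightarrow> smooth_on S g"
  by (simp add: smooth_on_def C_k_on_cong[of S f g])

lemma C_k_on_Suc_imp: "C_k_on (Suc k) f S \<Longrightarrow> C_k_on k f S"
proof (induction k arbitrary: f)
  case 0
  then have "f differentiable_on S"
    by (simp add: differentiable_on_def differentiable_at_withinI)
  then show ?case by (simp add: differentiable_imp_continuous_on)
next
  case (Suc k)
  then show ?case by (metis C_k_on.simps(2))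
qed

lemma smooth_on_differentiable: "smooth_on S f \<Longrightarrow> x \<in> S \<Longrightarrow> f differentiable at x"
  unfolding smooth_on_def by (metis C_k_on.simps(2))

lemma smooth_on_has_derivative: "smooth_on S f \<Longrightarrow> x \<in> S \<Longrightarrow> (f has_derivative D f x) (at x)"
  by (simp add: smooth_on_differentiable differentiable_D)

lemma smooth_on_linear: "smooth_on S f \<Longrightarrow> x \<in> S \<Longrightarrow> linear (D f x)"
  using has_derivative_linear smooth_on_has_derivative by blast

lemma smooth_on_continuous_on: "smooth_on S f \<Longrightarrow> continuous_on S f"
  unfolding smooth_on_def by (metis C_k_on.simps(1))

lemma smooth_on_D: "smooth_on S f \<Longrightarrow> smooth_on S (\<lambda>x. D f x v)"
  unfolding smooth_on_def by (metis C_k_on.simps(2))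

section \<open>Closure of smooth functions under algebraic operations\<close>

lemma C_k_on_const: "C_k_on k (\<lambda>x. c) S"
  by (induction k arbitrary: c) auto

lemma smooth_on_const: "smooth_on S (\<lambda>x. c)"
  by (simp add: smooth_on_def C_k_on_const)

lemma smooth_on_bounded_linear:
  assumes "bounded_linear f"
  shows "smooth_on S f"
proof -
  have d: "(f has_derivative f) (at x)" for x
    using assms by (simp add: bounded_linear_imp_has_derivative)
  then have "D f x = f" for x by (simp add: has_derivative_D)
  then have "C_k_on k f S" for k
    using d by (cases k) (auto simp: C_k_on_const differentiable_def
        intro: linear_continuous_on[OF assms])
  then show ?thesis by (simp add: smooth_on_def)
qed

lemma C_k_on_add:
  assumes "open S"
  shows "C_k_on k f S \<Longrightarrow> C_k_on k g S \<Longrightarrow> C_k_on k (\<lambda>x. f x + g x) S"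
proof (induction k arbitrary: f g)
  case 0
  then show ?case by (auto intro: continuous_on_add)
next
  case (Suc k)
  have "D (\<lambda>x. f x + g x) x v = D f x v + D g x v" if "x \<in> S" for x v
    using Suc.prems that by (subst has_derivative_D) (auto intro!: has_derivative_add differentiable_D)
  then have "C_k_on k (\<lambda>x. D (\<lambda>x. f x + g x) x v) S" for v
    using Suc by (subst C_k_on_cong[OF assms, where g="\<lambda>x. D f x v + D g x v"]) auto
  then show ?case using Suc.prems by auto
qed

text \<open>Induction on the order through the product rule: each summand pairs one function with a
  derivative of the other, and both are of class \<open>k\<close>. Products, scalar multiples and,
  with a constant first factor, compositions with bounded linear maps are all instances.\<close>

lemma C_k_on_bilinear:
  assumes "open S" and B: "bounded_bilinear B"
  shows "C_k_on k f S \<Longrightarrow> C_k_on k g S \<Longrightarrow> C_k_on k (\<lambda>x. B (f x) (g x)) S"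
proof (induction k arbitrary: f g)
  case 0
  then show ?case by (auto intro: bounded_bilinear.continuous_on[OF B])
next
  case (Suc k)
  have d: "((\<lambda>x. B (f x) (g x)) has_derivative (\<lambda>v. B (f x) (D g x v) + B (D f x v) (g x))) (at x)"
    if "x \<in> S" for x
    using Suc.prems that by (intro bounded_bilinear.FDERIV[OF B] differentiable_D) auto
  have "C_k_on k (\<lambda>x. D (\<lambda>x. B (f x) (g x)) x v) S" for v
  proof -
    have "C_k_on k (\<lambda>x. B (f x) (D g x v) + B (D f x v) (g x)) S"
      using Suc.prems by (intro C_k_on_add[OF assms(1)] Suc.IH) (auto intro: C_k_on_Suc_imp)
    then show ?thesis
      by (subst C_k_on_cong[OF assms(1), where g="\<lambda>x. B (f x) (D g x v) + B (D f x v) (g x)"])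
        (auto simp: has_derivative_D[OF d])
  qed
  then show ?case using d by (auto simp: differentiable_def)
qed

lemma smooth_on_add: "open S \<Longrightarrow> smooth_on S f \<Longrightarrow> smooth_on S g \<Longrightarrow> smooth_on S (\<lambda>x. f x + g x)"
  by (simp add: smooth_on_def C_k_on_add)

lemma smooth_on_bilinear:
  "open S \<Longrightarrow> bounded_bilinear B \<Longrightarrow> smooth_on S f \<Longrightarrow> smooth_on S g \<Longrightarrow> smooth_on S (\<lambda>x. B (f x) (g x))"
  by (simp add: smooth_on_def C_k_on_bilinear)

lemmas smooth_on_scaleR = smooth_on_bilinear[OF _ bounded_bilinear_scaleR]

lemma smooth_on_mult:
  fixes f g :: "'a::euclidean_space \<Rightarrow> real"
  shows "open S \<Longrightarrow> smooth_on S f \<Longrightarrow> smooth_on S g \<Longrightarrow> smooth_on S (\<lambda>x. f x * g x)"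
  using smooth_on_bilinear[OF _ bounded_bilinear_mult] by blast

lemma smooth_on_diff:
  assumes "open S" "smooth_on S f" "smooth_on S g"
  shows "smooth_on S (\<lambda>x. f x - g x)"
  using smooth_on_add[OF assms(1,2) smooth_on_scaleR[OF assms(1) smooth_on_const[of S "-1"] assms(3)]]
  by simp

lemma smooth_on_sum:
  "open S \<Longrightarrow> (\<And>i. i \<in> I \<Longrightarrow> smooth_on S (f i)) \<Longrightarrow> smooth_on S (\<lambda>x. \<Sum>i\<in>I. f i x)"
  by (induction I rule: infinite_finite_induct) (auto intro: smooth_on_const smooth_on_add)

lemma smooth_on_prod:
  fixes f :: "'i \<Rightarrow> 'a::euclidean_space \<Rightarrow> real"
  shows "open S \<Longrightarrow> (\<And>i. i \<in> I \<Longrightarrow> smooth_on S (f i)) \<Longrightarrow> smooth_on S (\<lambda>x. \<Prod>i\<in>I. f i x)"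
  by (induction I rule: infinite_finite_induct) (auto intro: smooth_on_const smooth_on_mult)

lemma smooth_on_bounded_linear_comp:
  assumes "open S" "smooth_on S f" "bounded_linear h"
  shows "smooth_on S (\<lambda>x. h (f x))"
proof -
  interpret h: bounded_linear h by fact
  have B: "bounded_bilinear (\<lambda>(a::real) b. a *\<^sub>R h b)"
    using bounded_bilinear.comp[OF bounded_bilinear_scaleR bounded_linear_ident assms(3)] .
  show ?thesis
    using smooth_on_bilinear[OF assms(1) B smooth_on_const[of S 1] assms(2)] by simp
qed

text \<open>The derivative of the reciprocal is a product of the reciprocal itself, twice, and a
  derivative of \<open>f\<close>; the induction hypothesis for the same \<open>f\<close> covers the
  reciprocal factors.\<close>

lemma C_k_on_inverse:
  fixes f :: "'a::euclidean_space \<Rightarrow> real"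
  assumes "open S" "\<And>x. x \<in> S \<Longrightarrow> f x \<noteq> 0"
  shows "C_k_on k f S \<Longrightarrow> C_k_on k (\<lambda>x. inverse (f x)) S"
proof (induction k)
  case 0
  then show ?case using assms by (auto intro: continuous_on_inverse)
next
  case (Suc k)
  have d: "((\<lambda>x. inverse (f x)) has_derivative (\<lambda>v. - (inverse (f x) * D f x v * inverse (f x)))) (at x)"
    if "x \<in> S" for x
    using Suc.prems that assms(2) by (intro Deriv.has_derivative_inverse differentiable_D) auto
  have "C_k_on k (\<lambda>x. D (\<lambda>x. inverse (f x)) x v) S" for v
  proof -
    have "C_k_on k (\<lambda>x. (-1) * ((inverse (f x) * D f x v) * inverse (f x))) S"
      using Suc.prems
      by (intro C_k_on_bilinear[OF assms(1) bounded_bilinear_mult] Suc.IH C_k_on_const)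
        (auto intro: C_k_on_Suc_imp)
    then show ?thesis
      by (subst C_k_on_cong[OF assms(1), where g="\<lambda>x. (-1) * ((inverse (f x) * D f x v) * inverse (f x))"])
        (auto simp: has_derivative_D[OF d])
  qed
  then show ?case using d by (auto simp: differentiable_def)
qed

lemma smooth_on_inverse:
  fixes f :: "'a::euclidean_space \<Rightarrow> real"
  shows "open S \<Longrightarrow> (\<And>x. x \<in> S \<Longrightarrow> f x \<noteq> 0) \<Longrightarrow> smooth_on S f \<Longrightarrow> smooth_on S (\<lambda>x. inverse (f x))"
  by (simp add: smooth_on_def C_k_on_inverse)

section \<open>Symmetry of second derivatives\<close>

lemma second_difference:
  fixes f :: "'a::euclidean_space \<Rightarrow> real"
  assumes sm: "smooth_on S f" and h: "0 < h"
    and sub: "\<And>a b. 0 \<le> a \<Longrightarrow> a \<le> h \<Longrightarrow> 0 \<le> b \<Longrightarrow> b \<le> h \<Longrightarrow> x + a *\<^sub>R v + b *\<^sub>R w \<in> S"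
  shows "\<exists>a b. 0 < a \<and> a < h \<and> 0 < b \<and> b < h \<and>
    f (x + h *\<^sub>R v + h *\<^sub>R w) - f (x + h *\<^sub>R v) - f (x + h *\<^sub>R w) + f x
      = h * h * D2 f (x + a *\<^sub>R v + b *\<^sub>R w) v w"
proof -
  have der: "((\<lambda>s. g (u + s *\<^sub>R e)) has_real_derivative D g (u + s *\<^sub>R e) e) (at s)"
    if "smooth_on S g" "u + s *\<^sub>R e \<in> S" for g :: "'a \<Rightarrow> real" and u e s
  proof -
    have "((\<lambda>s. g (u + s *\<^sub>R e)) has_derivative (\<lambda>r. D g (u + s *\<^sub>R e) (r *\<^sub>R e))) (at s)"
      by (rule has_derivative_compose[where g=g and f="\<lambda>s. u + s *\<^sub>R e" and x=s, OF _ smooth_on_has_derivative[OF that]])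
        (auto intro!: derivative_eq_intros)
    moreover have "(\<lambda>r. D g (u + s *\<^sub>R e) (r *\<^sub>R e)) = (*) (D g (u + s *\<^sub>R e) e)"
      using linear_cmul[OF smooth_on_linear[OF that]] by (auto simp: mult.commute)
    ultimately show ?thesis by (simp add: has_field_derivative_def)
  qed
  \<comment> \<open>The second difference is the increment over \<open>{0..h}\<close> of the first
    difference in direction \<open>w\<close>, read as a function of the displacement along
    \<open>v\<close>. The mean value theorem therefore applies to it.\<close>
  let ?p = "\<lambda>s. f ((x + h *\<^sub>R w) + s *\<^sub>R v) - f (x + s *\<^sub>R v)"
  have in1: "x + h *\<^sub>R w + s *\<^sub>R v \<in> S" "x + s *\<^sub>R v \<in> S" if "0 \<le> s" "s \<le> h" for s
    using sub[of s h] sub[of s 0] that h by (auto simp: algebra_simps)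
  have dp: "(?p has_real_derivative (D f ((x + h *\<^sub>R w) + s *\<^sub>R v) v - D f (x + s *\<^sub>R v) v)) (at s)"
    if "0 \<le> s" "s \<le> h" for s
    by (intro DERIV_diff der sm in1[OF that])
  obtain a where a: "0 < a" "a < h"
    "?p h - ?p 0 = (h - 0) * (D f ((x + h *\<^sub>R w) + a *\<^sub>R v) v - D f (x + a *\<^sub>R v) v)"
    using MVT2[OF h dp] by auto
  \<comment> \<open>What remains is an increment of \<open>D f _ v\<close> along \<open>w\<close>,
    to which the mean value theorem applies a second time.\<close>
  let ?q = "\<lambda>s. D f ((x + a *\<^sub>R v) + s *\<^sub>R w) v"
  have dq: "(?q has_real_derivative D2 f ((x + a *\<^sub>R v) + s *\<^sub>R w) v w) (at s)"
    if "0 \<le> s" "s \<le> h" for s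
    by (rule der[where g="\<lambda>y. D f y v", OF smooth_on_D[OF sm]])
      (use sub[of a s] a that in auto)
  obtain b where b: "0 < b" "b < h"
    "?q h - ?q 0 = (h - 0) * D2 f ((x + a *\<^sub>R v) + b *\<^sub>R w) v w"
    using MVT2[OF h dq] by auto
  show ?thesis
    using a b by (intro exI[of _ a] exI[of _ b]) (auto simp: algebra_simps)
qed

lemma isCont_nhds: "isCont g x \<Longrightarrow> (g \<longlongrightarrow> g x) (nhds x)"
  by (simp add: isCont_def tendsto_at_iff_tendsto_nhds)

text \<open>The second difference is unchanged when \<open>v\<close> and \<open>w\<close> are
  exchanged, while \<open>second_difference\<close> expresses it by either mixed derivative at a
  nearby point. Continuity of both mixed derivatives then excludes a gap at
  \<open>x\<close>.\<close>

lemma symmetric_D2_real: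
  fixes f :: "'a::euclidean_space \<Rightarrow> real"
  assumes S: "open S" "x \<in> S" and sm: "smooth_on S f"
  shows "D2 f x v w = D2 f x w v"
proof (rule ccontr)
  assume ne: "D2 f x v w \<noteq> D2 f x w v"
  \<comment> \<open>Half the gap: two values within \<open>e\<close> of the two mixed derivatives at
    \<open>x\<close> cannot be equal.\<close>
  define e where "e = \<bar>D2 f x v w - D2 f x w v\<bar> / 2"
  have e: "e > 0" using ne by (simp add: e_def)
  have "isCont (\<lambda>y. D2 f y v w) x" "isCont (\<lambda>y. D2 f y w v) x"
    using S smooth_on_continuous_on[OF smooth_on_D[OF smooth_on_D[OF sm]]]
    by (auto simp: continuous_on_eq_continuous_at)
  then have "\<forall>\<^sub>F y in nhds x. dist (D2 f y v w) (D2 f x v w) < e \<and> dist (D2 f y w v) (D2 f x w v) < e \<and> y \<in> S"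
    using e S
    by (intro eventually_conj tendstoD[OF isCont_nhds[of x "\<lambda>y. D2 f y v w"]]
        tendstoD[OF isCont_nhds[of x "\<lambda>y. D2 f y w v"]] eventually_nhds_in_open)
  then obtain d where d: "d > 0"
    "\<And>y. dist y x < d \<Longrightarrow> dist (D2 f y v w) (D2 f x v w) < e \<and> dist (D2 f y w v) (D2 f x w v) < e \<and> y \<in> S"
    by (auto simp: eventually_nhds_metric)
  \<comment> \<open>This keeps the whole parallelogram spanned by \<open>h *\<^sub>R v\<close> and
    \<open>h *\<^sub>R w\<close> in the ball of radius \<open>d\<close>; the summand 1 gives a
    strict inequality and a nonzero denominator even when \<open>v\<close> and \<open>w\<close>
    vanish.\<close>
  define h where "h = d / (norm v + norm w + 1)"
  have h: "h > 0" using d by (simp add: h_def add_nonneg_pos)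
  have nb: "dist (x + a *\<^sub>R v + b *\<^sub>R w) x < d" if "0 \<le> a" "a \<le> h" "0 \<le> b" "b \<le> h" for a b
  proof -
    have "dist (x + a *\<^sub>R v + b *\<^sub>R w) x = norm (a *\<^sub>R v + b *\<^sub>R w)"
      by (simp add: dist_norm algebra_simps)
    also have "\<dots> \<le> a * norm v + b * norm w"
      using norm_triangle_ineq[of "a *\<^sub>R v" "b *\<^sub>R w"] that by simp
    also have "\<dots> \<le> h * norm v + h * norm w"
      using that by (intro add_mono mult_right_mono) auto
    also have "\<dots> < h * (norm v + norm w + 1)" using h by (simp add: algebra_simps)
    also have "\<dots> = d" 
      by (simp add: h_def) (metis add_nonneg_pos add_nonneg_nonneg norm_ge_zero zero_less_one less_irrefl)
    finally show ?thesis .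
  qed
  obtain a b where ab: "0 < a" "a < h" "0 < b" "b < h"
    "f (x + h *\<^sub>R v + h *\<^sub>R w) - f (x + h *\<^sub>R v) - f (x + h *\<^sub>R w) + f x
      = h * h * D2 f (x + a *\<^sub>R v + b *\<^sub>R w) v w"
    using second_difference[OF sm h, of x v w] d(2)[OF nb] by blast
  have nb': "dist (x + a *\<^sub>R w + b *\<^sub>R v) x < d" if "0 \<le> a" "a \<le> h" "0 \<le> b" "b \<le> h" for a b
    using nb[OF that(3,4,1,2)] by (simp add: algebra_simps)
  obtain a' b' where ab': "0 < a'" "a' < h" "0 < b'" "b' < h"
    "f (x + h *\<^sub>R w + h *\<^sub>R v) - f (x + h *\<^sub>R w) - f (x + h *\<^sub>R v) + f x
      = h * h * D2 f (x + a' *\<^sub>R w + b' *\<^sub>R v) w v"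
    using second_difference[OF sm h, of x w v] d(2)[OF nb'] by blast
  have "h * h * D2 f (x + a *\<^sub>R v + b *\<^sub>R w) v w = h * h * D2 f (x + a' *\<^sub>R w + b' *\<^sub>R v) w v"
    unfolding ab(5)[symmetric] ab'(5)[symmetric] by (simp add: algebra_simps)
  then have "D2 f (x + a *\<^sub>R v + b *\<^sub>R w) v w = D2 f (x + a' *\<^sub>R w + b' *\<^sub>R v) w v"
    using h by simp
  moreover have "dist (D2 f (x + a *\<^sub>R v + b *\<^sub>R w) v w) (D2 f x v w) < e"
    using d(2)[OF nb[of a b]] ab by auto
  moreover have "dist (D2 f (x + a' *\<^sub>R w + b' *\<^sub>R v) w v) (D2 f x w v) < e"
    using d(2)[OF nb'[of a' b']] ab' by auto
  ultimately show False unfolding e_def dist_real_def by argo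
qed

lemma D_bounded_linear_comp:
  assumes "f differentiable at x" "bounded_linear h"
  shows "D (\<lambda>y. h (f y)) x v = h (D f x v)"
  using has_derivative_D[OF bounded_linear.has_derivative[OF assms(2) differentiable_D[OF assms(1)]]]
  by simp

lemma symmetric_D2:
  fixes f :: "'a::euclidean_space \<Rightarrow> 'b::euclidean_space"
  assumes S: "open S" "x \<in> S" and sm: "smooth_on S f"
  shows "D2 f x v w = D2 f x w v"
proof (rule euclidean_eqI)
  fix b :: 'b
  assume "b \<in> Basis"
  have i: "bounded_linear (\<lambda>y. y \<bullet> b)" by (rule bounded_linear_inner_left)
  have 2: "D2 (\<lambda>y. f y \<bullet> b) x v w = D2 f x v w \<bullet> b" for v w
  proof -
    have "D2 (\<lambda>y. f y \<bullet> b) x v w = D (\<lambda>y. D f y v \<bullet> b) x w"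
      using D_bounded_linear_comp[OF smooth_on_differentiable[OF sm] i]
      by (subst D_cong_open[OF S, where g="\<lambda>y. D f y v \<bullet> b"]) auto
    then show ?thesis
      using D_bounded_linear_comp[OF smooth_on_differentiable[OF smooth_on_D[OF sm] S(2)] i] by simp
  qed
  show "D2 f x v w \<bullet> b = D2 f x w v \<bullet> b"
    using symmetric_D2_real[OF S smooth_on_bounded_linear_comp[OF S(1) sm i]] 2 by simp
qed

lemma D_euclidean: "linear L \<Longrightarrow> L u = (\<Sum>b\<in>Basis. (u \<bullet> b) *\<^sub>R L b)"
  by (metis (no_types, lifting) euclidean_representation linear_cmul linear_sum sum.cong)

text \<open>Derivative of the fibre part of the tangent map of \<open>f\<close>. Smoothness speaks
  about \<open>D f _ b\<close> for a fixed direction \<open>b\<close> only, so the moving direction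
  is expanded in the basis and the product rule is applied to each term.\<close>

lemma has_derivative_D_apply:
  fixes f :: "'a::euclidean_space \<Rightarrow> 'b::euclidean_space"
  assumes S: "open S" "x \<in> S" and sm: "smooth_on S f"
  shows "((\<lambda>z. D f (fst z) (snd z)) has_derivative (\<lambda>z. D2 f x u (fst z) + D f x (snd z))) (at (x, u))"
proof -
  have op: "open (S \<times> (UNIV :: 'a set))" by (intro open_Times S) auto
  have d: "((\<lambda>y. D f y b) has_derivative (\<lambda>w. D2 f x b w)) (at (fst (x, u)))" for b
    using smooth_on_has_derivative[OF smooth_on_D[OF sm] S(2)] by simp
  have "((\<lambda>z. \<Sum>b\<in>Basis. (snd z \<bullet> b) *\<^sub>R D f (fst z) b) has_derivative
      (\<lambda>z. \<Sum>b\<in>Basis. (snd (x, u) \<bullet> b) *\<^sub>R D2 f x b (fst z) + (snd z \<bullet> b) *\<^sub>R D f (fst (x,u)) b))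
    (at (x, u))"
    by (intro has_derivative_sum has_derivative_scaleR has_derivative_inner_left
        has_derivative_snd has_derivative_ident
        has_derivative_compose[where g="\<lambda>y. D f y b" for b, OF has_derivative_fst[OF has_derivative_ident] d])
  moreover have "(\<Sum>b\<in>Basis. (snd (x, u) \<bullet> b) *\<^sub>R D2 f x b (fst z) + (snd z \<bullet> b) *\<^sub>R D f (fst (x,u)) b)
     = D2 f x u (fst z) + D f x (snd z)" for z
  proof -
    \<comment> \<open>Reassembling the basis expansion requires linearity in the inner direction,
      which symmetry moves to the outer slot.\<close>
    have "linear (\<lambda>v. D2 f x v (fst z))"
      unfolding symmetric_D2[OF S sm, of _ "fst z"]
      by (rule smooth_on_linear[OF smooth_on_D[OF sm] S(2)])
    from D_euclidean[OF this, of u] D_euclidean[OF smooth_on_linear[OF sm S(2)], of "snd z"]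
    show ?thesis by (simp add: sum.distrib)
  qed
  ultimately have "((\<lambda>z. \<Sum>b\<in>Basis. (snd z \<bullet> b) *\<^sub>R D f (fst z) b) has_derivative
      (\<lambda>z. D2 f x u (fst z) + D f x (snd z))) (at (x, u))"
    by simp
  then show ?thesis
  proof (rule has_derivative_transform_within_open[OF _ op])
    fix z assume "z \<in> S \<times> (UNIV :: 'a set)"
    then have "linear (D f (fst z))" using smooth_on_linear[OF sm] by auto
    from D_euclidean[OF this, of "snd z"]
    show "(\<Sum>b\<in>Basis. (snd z \<bullet> b) *\<^sub>R D f (fst z) b) = D f (fst z) (snd z)" by simp
  qed (use S in auto)
qed

lemma linear_D2_left:
  assumes "open S" "x \<in> S" "smooth_on S f"
  shows "linear (\<lambda>v. D2 f x v w)"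
  unfolding symmetric_D2[OF assms, of _ w]
  by (rule smooth_on_linear[OF smooth_on_D[OF assms(3)] assms(2)])

lemma linear_D2_right:
  assumes "x \<in> S" "smooth_on S f"
  shows "linear (\<lambda>w. D2 f x v w)"
  by (rule smooth_on_linear[OF smooth_on_D[OF assms(2)] assms(1)])

lemma smooth_on_vec:
  fixes f :: "'a::euclidean_space \<Rightarrow> real ^ 'n"
  assumes "open S" "\<And>i. smooth_on S (\<lambda>x. f x $ i)"
  shows "smooth_on S f"
proof -
  have "f x = (\<Sum>i\<in>UNIV. (f x $ i) *\<^sub>R axis i 1)" for x
    by (simp add: vec_eq_iff sum_component axis_def if_distrib cong: if_cong)
  moreover have "smooth_on S (\<lambda>x. \<Sum>i\<in>UNIV. (f x $ i) *\<^sub>R (axis i 1 :: real ^ 'n))"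
    by (intro smooth_on_sum smooth_on_scaleR smooth_on_const assms)
  ultimately show ?thesis by simp
qed

lemma smooth_on_Pair:
  assumes "open S" "smooth_on S f" "smooth_on S g"
  shows "smooth_on S (\<lambda>x. (f x, g x))"
proof -
  have "smooth_on S (\<lambda>x. (f x, 0) + (0, g x))"
    by (intro smooth_on_add smooth_on_bounded_linear_comp[OF _ assms(2)]
        smooth_on_bounded_linear_comp[OF _ assms(3)] assms bounded_linear_Pair
        bounded_linear_ident bounded_linear_zero)
  then show ?thesis by simp
qed

section \<open>Homogeneous functions and sprays\<close>

text \<open>Positive homogeneity in the fibre, restricted to nonzero vectors because that is where
  Finsler functions and sprays are smooth.\<close>

definition homogeneous_on :: "(real ^ 'p) set \<Rightarrow> nat \<Rightarrow> 'p::finite phase_fun \<Rightarrow> bool" where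
  "homogeneous_on U k f \<longleftrightarrow> (\<forall>t\<in>U. \<forall>s. s \<noteq> 0 \<longrightarrow> (\<forall>r>0. f (t, r *\<^sub>R s) = r ^ k * f (t, s)))"

lemma open_slit: "open U \<Longrightarrow> open (U \<times> (UNIV - {0 :: 'a::real_normed_vector}))"
  by (intro open_Times open_Diff) auto

lemma linear_Pair_split:
  assumes "linear h"
  shows "h (u, w) = h (u, 0) + h (0, w)"
  using linear_add[OF assms, of "(u, 0)" "(0, w)"] by simp

lemma linear_fst_part: "linear h \<Longrightarrow> linear (\<lambda>u. h (u, 0))"
  using linear_compose[of "\<lambda>u. (u, 0)" h] by (simp add: o_def linear_iff)

lemma linear_snd_part: "linear h \<Longrightarrow> linear (\<lambda>u. h (0, u))"
  using linear_compose[of "\<lambda>u. (0, u)" h] by (simp add: o_def linear_iff)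

lemma linear_axis_sum:
  fixes h :: "real ^ 'p::finite \<Rightarrow> 'b::real_vector"
  assumes "linear h"
  shows "h u = (\<Sum>\<alpha>\<in>UNIV. u $ \<alpha> *\<^sub>R h (axis \<alpha> 1))"
proof -
  have "u = (\<Sum>\<alpha>\<in>UNIV. u $ \<alpha> *\<^sub>R axis \<alpha> 1)"
    by (simp add: vec_eq_iff sum_component axis_def if_distrib cong: if_cong)
  then have "h u = h (\<Sum>\<alpha>\<in>UNIV. u $ \<alpha> *\<^sub>R axis \<alpha> 1)" by simp
  then show ?thesis using assms by (simp add: linear_sum linear_cmul)
qed

lemma linear_eq_iff_axis:
  fixes h k :: "real ^ 'p::finite \<Rightarrow> 'b::real_vector"
  assumes "linear h" "linear k"
  shows "(\<forall>u. h u = k u) \<longleftrightarrow> (\<forall>\<alpha>. h (axis \<alpha> 1) = k (axis \<alpha> 1))"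
  by (metis (no_types, lifting) linear_axis_sum[OF assms(1)] linear_axis_sum[OF assms(2)] sum.cong)

lemma has_derivative_fst_part:
  assumes "f differentiable at (t, s)"
  shows "((\<lambda>t. f (t, s)) has_derivative (\<lambda>u. D f (t, s) (u, 0))) (at t)"
  by (rule has_derivative_compose[where g=f and f="\<lambda>t. (t, s)" and x=t,
        OF _ differentiable_D[OF assms]])
    (auto intro!: derivative_eq_intros)

lemma has_derivative_snd_part:
  assumes "f differentiable at (t, s)"
  shows "((\<lambda>s. f (t, s)) has_derivative (\<lambda>u. D f (t, s) (0, u))) (at s)"
  by (rule has_derivative_compose[where g=f and f="\<lambda>s. (t, s)" and x=s,
        OF _ differentiable_D[OF assms]])
    (auto intro!: derivative_eq_intros)

text \<open>A derivative in a base direction sees only the slice of constant \<open>s\<close>;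
  differentiability identifies it with the derivative of the function restricted to that
  slice.\<close>

lemma D_fst_cong:
  assumes "open U" "t \<in> U" "f differentiable at (t, s)" "g differentiable at (t, s)"
    and "\<And>y. y \<in> U \<Longrightarrow> f (y, s) = g (y, s)"
  shows "D f (t, s) (u, 0) = D g (t, s) (u, 0)"
  using has_derivative_D[OF has_derivative_fst_part[OF assms(3)]]
    has_derivative_D[OF has_derivative_fst_part[OF assms(4)]]
    D_cong_open[OF assms(1,2), of "\<lambda>y. f (y, s)" "\<lambda>y. g (y, s)"] assms(5) by metis

text \<open>Differentiation of the homogeneity identity in \<open>t\<close> and \<open>s\<close> at
  once. Setting \<open>w\<close> or \<open>u\<close> to zero separates the base derivatives, which
  keep their degree, from the fibre derivatives, which lose one.\<close>

lemma homogeneous_on_scaled_D: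
  fixes U :: "(real ^ 'p::finite) set"
  assumes h: "homogeneous_on U k f" and U: "open U"
    and sm: "smooth_on (U \<times> (UNIV - {0})) f" and t: "t \<in> U" and s: "s \<noteq> 0" and r: "r > 0"
  shows "D f (t, r *\<^sub>R s) (u, r *\<^sub>R w) = r ^ k * D f (t, s) (u, w)"
proof -
  let ?W = "U \<times> (UNIV - {0 :: real ^ 'p})"
  have W: "open ?W" using U by (rule open_slit)
  have 1: "((\<lambda>z. f (fst z, r *\<^sub>R snd z)) has_derivative (\<lambda>z. D f (t, r *\<^sub>R s) (fst z, r *\<^sub>R snd z))) (at (t, s))"
  proof (rule has_derivative_compose[where g=f and f="\<lambda>z. (fst z, r *\<^sub>R snd z)" and x="(t, s)"])
    show "((\<lambda>z. (fst z, r *\<^sub>R snd z)) has_derivative (\<lambda>z. (fst z, r *\<^sub>R snd z))) (at (t, s))"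
      by (auto intro!: derivative_eq_intros)
    show "(f has_derivative D f (t, r *\<^sub>R s)) (at (fst (t, s), r *\<^sub>R snd (t, s)))"
      using smooth_on_has_derivative[OF sm, of "(t, r *\<^sub>R s)"] t s r by simp
  qed
  have 2: "((\<lambda>z. r ^ k * f z) has_derivative (\<lambda>z. r ^ k * D f (t, s) z)) (at (t, s))"
    using smooth_on_has_derivative[OF sm, of "(t, s)"] t s by (intro has_derivative_mult_right) auto
  have "D (\<lambda>z. f (fst z, r *\<^sub>R snd z)) (t, s) = D (\<lambda>z. r ^ k * f z) (t, s)"
  proof (rule D_cong_open[OF W])
    fix z :: "(real ^ 'p) \<times> (real ^ 'p)"
    assume "z \<in> ?W"
    then have "fst z \<in> U" "snd z \<noteq> 0" by auto
    then have "f (fst z, r *\<^sub>R snd z) = r ^ k * f (fst z, snd z)"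
      using h r by (auto simp: homogeneous_on_def)
    then show "f (fst z, r *\<^sub>R snd z) = r ^ k * f z" by simp
  qed (use t s in auto)
  then have "(\<lambda>z. D f (t, r *\<^sub>R s) (fst z, r *\<^sub>R snd z)) = (\<lambda>z. r ^ k * D f (t, s) z)"
    by (simp only: has_derivative_D[OF 1] has_derivative_D[OF 2])
  from fun_cong[OF this, of "(u, w)"] show ?thesis by simp
qed

lemma homogeneous_on_D_fst:
  assumes "homogeneous_on U k f" "open U" "smooth_on (U \<times> (UNIV - {0})) f"
  shows "homogeneous_on U k (\<lambda>z. D f z (u, 0))"
  unfolding homogeneous_on_def using homogeneous_on_scaled_D[OF assms, where w=0 and u=u] by simp

text \<open>The inner derivative of the rescaling contributes a factor \<open>r\<close>; cancelling
  it lowers the degree by one. Degrees are written with \<open>Suc\<close> so that successive fibre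
  derivatives can peel them off.\<close>

lemma homogeneous_on_D_snd:
  assumes "homogeneous_on U (Suc k) f" "open U" "smooth_on (U \<times> (UNIV - {0})) f"
  shows "homogeneous_on U k (\<lambda>z. D f z (0, w))"
  unfolding homogeneous_on_def
proof (intro ballI allI impI)
  fix t s :: "real ^ 'a" and r :: real
  assume *: "t \<in> U" "s \<noteq> 0" "r > 0"
  have "linear (D f (t, r *\<^sub>R s))"
    using * by (intro smooth_on_linear[OF assms(3)]) auto
  then have "D f (t, r *\<^sub>R s) (0, r *\<^sub>R w) = r * D f (t, r *\<^sub>R s) (0, w)"
    using linear_cmul[of "D f (t, r *\<^sub>R s)" r "(0, w)"] by simp
  with homogeneous_on_scaled_D[OF assms *, of 0 w] * 
  show "D f (t, r *\<^sub>R s) (0, w) = r ^ k * D f (t, s) (0, w)" by simp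
qed

text \<open>The function \<open>r\<close> to \<open>f (t, r *\<^sub>R s)\<close> is differentiated
  at 1 in two ways, by the chain rule and as a power of \<open>r\<close>.\<close>

lemma euler_homogeneous:
  assumes h: "homogeneous_on U k f" and sm: "smooth_on (U \<times> (UNIV - {0})) f"
    and t: "t \<in> U" and s: "s \<noteq> 0"
  shows "D f (t, s) (0, s) = k * f (t, s)"
proof -
  have d: "(f has_derivative D f (t, s)) (at (t, s))"
    by (rule smooth_on_has_derivative[OF sm]) (use t s in auto)
  have "((\<lambda>r. f (t, r *\<^sub>R s)) has_derivative (\<lambda>r. D f (t, s) (0, r *\<^sub>R s))) (at (1::real))"
    by (rule has_derivative_compose[where g=f and f="\<lambda>r. (t, r *\<^sub>R s)" and x="1::real"])
      (use d in \<open>auto intro!: derivative_eq_intros\<close>)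
  moreover have "(\<lambda>r. D f (t, s) (0, r *\<^sub>R s)) = (*) (D f (t, s) (0, s))"
    using linear_cmul[OF has_derivative_linear[OF d], of _ "(0, s)"] by (auto simp: mult.commute)
  ultimately have 1: "((\<lambda>r. f (t, r *\<^sub>R s)) has_real_derivative D f (t, s) (0, s)) (at 1)"
    by (simp add: has_field_derivative_def)
  have 2: "((\<lambda>r. r ^ k * f (t, s)) has_real_derivative k * f (t, s)) (at 1)"
    by (auto intro!: derivative_eq_intros)
  have "((\<lambda>r. f (t, r *\<^sub>R s)) has_real_derivative k * f (t, s)) (at 1)"
    by (rule has_field_derivative_transform_within_open[OF 2, of "{0<..}"])
      (use h t s in \<open>auto simp: homogeneous_on_def\<close>)
  then show ?thesis using 1 DERIV_unique by blast
qed

section \<open>Determinants and inverse matrices\<close>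

lemma smooth_on_det:
  fixes M :: "'a::euclidean_space \<Rightarrow> real ^ 'n ^ 'n"
  assumes "open S" "\<And>i j. smooth_on S (\<lambda>x. M x $ i $ j)"
  shows "smooth_on S (\<lambda>x. det (M x))"
  unfolding det_def
  by (intro smooth_on_sum smooth_on_mult smooth_on_const smooth_on_prod assms)

lemma matrix_mult_matrix_inv:
  fixes M :: "real ^ 'n ^ 'n"
  assumes "det M \<noteq> 0"
  shows "M ** matrix_inv M = mat 1"
proof -
  have "\<exists>A. M ** A = mat 1 \<and> A ** M = mat 1"
    using assms invertible_det_nz[of M] by (simp add: invertible_def)
  from someI_ex[OF this] show ?thesis by (simp add: matrix_inv_def)
qed

text \<open>Cramer's rule for the columns of the inverse. As quotients of determinants, the entries
  of the inverse metric become smooth by the algebraic closure properties alone.\<close>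

lemma matrix_inv_cramer:
  fixes M :: "real ^ 'n ^ 'n"
  assumes "det M \<noteq> 0"
  shows "matrix_inv M $ a $ b = det (\<chi> i j. if j = a then axis b 1 $ i else M $ i $ j) * inverse (det M)"
proof -
  have "M *v (matrix_inv M *v axis b 1) = axis b 1"
    by (simp add: matrix_vector_mul_assoc matrix_mult_matrix_inv[OF assms])
  then have "matrix_inv M *v axis b 1 =
      (\<chi> k. det (\<chi> i j. if j = k then axis b 1 $ i else M $ i $ j) / det M)"
    using cramer[OF assms] by blast
  moreover have "(matrix_inv M *v axis b 1) $ a = matrix_inv M $ a $ b"
    by (simp add: matrix_vector_mul_component inner_axis)
  ultimately show ?thesis by (simp add: divide_inverse)
qed

section \<open>The Finsler metric, its spray and the Euler--Lagrange equation in one chart\<close>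

locale local_finsler =
  fixes U :: "(real ^ 'p::finite) set" and L :: "'p phase_fun"
  assumes open_U: "open U"
    and smooth_L: "smooth_on (U \<times> (UNIV - {0})) L"
    and homogeneous_L: "homogeneous_on U 1 L"
    and metric_pos: "t \<in> U \<Longrightarrow> s \<noteq> 0 \<Longrightarrow> w \<noteq> 0 \<Longrightarrow>
      (\<Sum>\<alpha>\<in>UNIV. \<Sum>\<beta>\<in>UNIV. metric L \<alpha> \<beta> (t, s) * w $ \<alpha> * w $ \<beta>) > 0"
begin

abbreviation W :: "((real ^ 'p) \<times> (real ^ 'p)) set" where "W \<equiv> U \<times> (UNIV - {0})"
abbreviation Q where "Q \<equiv> \<lambda>z. (L z)\<^sup>2"

lemma open_W: "open W"
  using open_U by (rule open_slit)

lemma smooth_Q: "smooth_on W Q"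
  unfolding power2_eq_square by (intro smooth_on_mult open_W smooth_L)

lemma homogeneous_Q: "homogeneous_on U (Suc (Suc 0)) Q"
  using homogeneous_L by (auto simp: homogeneous_on_def power2_eq_square)

lemma metric_eq: "metric L \<alpha> \<beta> z = D2 Q z (0, axis \<beta> 1) (0, axis \<alpha> 1) / 2"
  by (simp add: metric_def partial_s_def)

lemma smooth_metric: "smooth_on W (metric L \<alpha> \<beta>)"
proof -
  have "smooth_on W (\<lambda>z. (1/2) * D2 Q z (0, axis \<beta> 1) (0, axis \<alpha> 1))"
    by (intro smooth_on_mult smooth_on_const open_W smooth_on_D smooth_Q)
  then show ?thesis unfolding metric_eq[abs_def] by simp
qed

lemma homogeneous_metric: "homogeneous_on U 0 (metric L \<alpha> \<beta>)"
proof -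
  have "homogeneous_on U 0 (\<lambda>z. D2 Q z (0, axis \<beta> 1) (0, axis \<alpha> 1))"
    by (intro homogeneous_on_D_snd open_U smooth_on_D smooth_Q homogeneous_Q)
  then show ?thesis by (simp add: homogeneous_on_def metric_eq)
qed

lemma metric_alt: "z \<in> W \<Longrightarrow> metric L \<alpha> \<beta> z = D2 Q z (0, axis \<alpha> 1) (0, axis \<beta> 1) / 2"
  unfolding metric_eq using symmetric_D2[OF open_W _ smooth_Q] by simp

text \<open>Pairing the linear system with \<open>w\<close> produces the quadratic form of the
  metric, which is positive unless \<open>w\<close> is zero. This both makes the metric invertible
  and later allows an index to be raised in \<open>euler_lagrange_iff\<close>.\<close>

lemma metric_kernel:
  assumes "z \<in> W" "\<And>\<alpha>. (\<Sum>\<beta>\<in>UNIV. metric L \<alpha> \<beta> z * w $ \<beta>) = 0"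
  shows "w = 0"
proof (rule ccontr)
  assume "w \<noteq> 0"
  obtain t s where z: "z = (t, s)" "t \<in> U" "s \<noteq> 0" using assms(1) by auto
  have "(\<Sum>\<alpha>\<in>UNIV. \<Sum>\<beta>\<in>UNIV. metric L \<alpha> \<beta> (t, s) * w $ \<alpha> * w $ \<beta>)
      = (\<Sum>\<alpha>\<in>UNIV. w $ \<alpha> * (\<Sum>\<beta>\<in>UNIV. metric L \<alpha> \<beta> (t, s) * w $ \<beta>))"
    by (simp add: sum_distrib_left mult_ac)
  also have "\<dots> = 0" using assms(2) z by simp
  finally show False using metric_pos[OF z(2,3) \<open>w \<noteq> 0\<close>] by simp
qed

lemma det_metric_nonzero:
  assumes "z \<in> W"
  shows "det (\<chi> \<mu> \<nu>. metric L \<mu> \<nu> z) \<noteq> 0"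
proof -
  let ?M = "\<chi> \<mu> \<nu>. metric L \<mu> \<nu> z"
  have "w = 0" if "?M *v w = 0" for w
    by (rule metric_kernel[OF assms])
      (use that in \<open>simp add: vec_eq_iff matrix_vector_mult_def\<close>)
  then have "\<exists>B. B ** ?M = mat 1"
    using matrix_left_invertible_ker[of ?M] by blast
  then show ?thesis using invertible_det_nz invertible_left_inverse by blast
qed

lemma smooth_metric_inv: "smooth_on W (metric_inv L \<alpha> \<beta>)"
proof -
  let ?M = "\<lambda>z. \<chi> \<mu> \<nu>. metric L \<mu> \<nu> z"
  have "smooth_on W (\<lambda>z. det (\<chi> i j. if j = \<alpha> then axis \<beta> 1 $ i else ?M z $ i $ j) * inverse (det (?M z)))"
  proof (intro smooth_on_mult smooth_on_inverse smooth_on_det open_W)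
    fix i j
    show "smooth_on W (\<lambda>z. (\<chi> i j. if j = \<alpha> then axis \<beta> 1 $ i else ?M z $ i $ j) $ i $ j)"
      by (cases "j = \<alpha>") (simp_all add: smooth_metric smooth_on_const)
    show "smooth_on W (\<lambda>z. ?M z $ i $ j)" by (simp add: smooth_metric)
  qed (rule det_metric_nonzero)
  then show ?thesis
    by (subst smooth_on_cong[OF open_W]) (simp_all add: metric_inv_def matrix_inv_cramer[OF det_metric_nonzero])
qed

lemma metric_metric_inv:
  assumes "z \<in> W"
  shows "(\<Sum>\<mu>\<in>UNIV. metric L \<delta> \<mu> z * metric_inv L \<mu> \<epsilon> z) = (if \<delta> = \<epsilon> then 1 else 0)"
proof -
  let ?M = "\<chi> \<mu> \<nu>. metric L \<mu> \<nu> z"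
  have "?M ** matrix_inv ?M = mat 1"
    by (rule matrix_mult_matrix_inv[OF det_metric_nonzero[OF assms]])
  then have "(?M ** matrix_inv ?M) $ \<delta> $ \<epsilon> = mat 1 $ \<delta> $ \<epsilon>" by simp
  then show ?thesis by (simp add: matrix_matrix_mult_def mat_def metric_inv_def)
qed

lemma smooth_spray: "smooth_on W (spray L \<mu>)"
proof -
  have c: "smooth_on W (\<lambda>z. snd z $ \<alpha>)" for \<alpha>
    by (intro smooth_on_bounded_linear bounded_linear_compose[OF bounded_linear_vec_nth] bounded_linear_snd)
  have i: "smooth_on W (\<lambda>z. metric_inv L \<mu> \<epsilon> z / 2)" for \<epsilon>
    using smooth_on_mult[OF open_W smooth_metric_inv smooth_on_const[of _ "1/2"]] by simp
  have t: "smooth_on W (partial_t \<alpha> (metric L \<epsilon> \<beta>))" for \<alpha> \<epsilon> \<beta>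
    unfolding partial_t_def by (intro smooth_on_D smooth_metric)
  have ch: "smooth_on W (christoffel L \<mu> \<alpha> \<beta>)" for \<alpha> \<beta>
    unfolding christoffel_def
    by (intro smooth_on_sum smooth_on_mult smooth_on_diff smooth_on_add i t open_W)
  have "smooth_on W (\<lambda>z. 1/2 * (\<Sum>\<alpha>\<in>UNIV. \<Sum>\<beta>\<in>UNIV. christoffel L \<mu> \<alpha> \<beta> z * snd z $ \<alpha> * snd z $ \<beta>))"
    by (intro smooth_on_sum smooth_on_mult smooth_on_const ch c open_W)
  then show ?thesis unfolding spray_def case_prod_unfold by simp
qed

text \<open>The metric, its inverse and its base derivatives have degree 0 in \<open>s\<close>, so
  all scaling comes from the two explicit factors of \<open>s\<close>.\<close>

lemma homogeneous_spray: "homogeneous_on U (Suc (Suc 0)) (spray L \<mu>)"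
proof -
  have "metric_inv L \<mu> \<epsilon> (t, r *\<^sub>R s) = metric_inv L \<mu> \<epsilon> (t, s)"
    if "t \<in> U" "s \<noteq> 0" "r > 0" for t s \<epsilon> and r :: real
    unfolding metric_inv_def using homogeneous_metric that by (simp add: homogeneous_on_def)
  moreover have "partial_t \<alpha> (metric L \<epsilon> \<beta>) (t, r *\<^sub>R s) = partial_t \<alpha> (metric L \<epsilon> \<beta>) (t, s)"
    if "t \<in> U" "s \<noteq> 0" "r > 0" for t s \<alpha> \<beta> \<epsilon> and r :: real
    unfolding partial_t_def
    using homogeneous_on_D_fst[OF homogeneous_metric open_U smooth_metric] that
    by (simp add: homogeneous_on_def)
  ultimately have "christoffel L \<mu> \<alpha> \<beta> (t, r *\<^sub>R s) = christoffel L \<mu> \<alpha> \<beta> (t, s)"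
    if "t \<in> U" "s \<noteq> 0" "r > 0" for t s \<alpha> \<beta> and r :: real
    unfolding christoffel_def using that by simp
  then show ?thesis
    by (auto simp: homogeneous_on_def spray_def sum_distrib_left mult_ac)
qed

lemma nonlinear_connection_contract:
  assumes "t \<in> U" "s \<noteq> 0"
  shows "(\<Sum>\<beta>\<in>UNIV. nonlinear_connection L \<alpha> \<beta> (t, s) * s $ \<beta>) = 2 * spray L \<alpha> (t, s)"
proof -
  have "linear (D (spray L \<alpha>) (t, s))"
    by (rule smooth_on_linear[OF smooth_spray]) (use assms in auto)
  from linear_axis_sum[OF linear_snd_part[OF this], of s] euler_homogeneous[OF homogeneous_spray smooth_spray assms]
  show ?thesis by (simp add: nonlinear_connection_def partial_s_def mult.commute)
qed

text \<open>Euler's relation used twice: the fibre derivative in a fixed direction has degree 1 and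
  contributes the factor 1, the spray itself has degree 2 and contributes the factor 2.\<close>

lemma D2_spray_contract:
  assumes "t \<in> U" "s \<noteq> 0"
  shows "D2 (spray L \<gamma>) (t, s) (0, s) (0, s) = 2 * spray L \<gamma> (t, s)"
proof -
  have "D2 (spray L \<gamma>) (t, s) (0, s) (0, s) = D (spray L \<gamma>) (t, s) (0, s)"
    using euler_homogeneous[OF homogeneous_on_D_snd[OF homogeneous_spray open_U smooth_spray]
        smooth_on_D[OF smooth_spray] assms] by simp
  then show ?thesis using euler_homogeneous[OF homogeneous_spray smooth_spray assms] by simp
qed

lemma berwald_eq: "berwald L \<gamma> \<alpha> \<beta> z = D2 (spray L \<gamma>) z (0, axis \<beta> 1) (0, axis \<alpha> 1)"
  by (simp add: berwald_def partial_s_def)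

text \<open>Euler's relation for the fibre derivative of \<open>Q\<close>, which has degree 1; the
  factor 1/2 is the one in the metric.\<close>

lemma metric_contract:
  assumes "t \<in> U" "s \<noteq> 0"
  shows "(\<Sum>\<alpha>\<in>UNIV. s $ \<alpha> * metric L \<delta> \<alpha> (t, s)) = D Q (t, s) (0, axis \<delta> 1) / 2"
proof -
  have z: "(t, s) \<in> W" using assms by auto
  have "(\<Sum>\<alpha>\<in>UNIV. s $ \<alpha> * D2 Q (t, s) (0, axis \<alpha> 1) (0, axis \<delta> 1)) = D2 Q (t, s) (0, axis \<delta> 1) (0, s)"
    using linear_axis_sum[OF linear_snd_part[OF linear_D2_right[OF z smooth_Q]], of "(0, axis \<delta> 1)" s]
    by (simp add: symmetric_D2[OF open_W z smooth_Q, of "(0, axis \<delta> 1)"])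
  also have "\<dots> = D Q (t, s) (0, axis \<delta> 1)"
    using euler_homogeneous[OF homogeneous_on_D_snd[OF homogeneous_Q open_U smooth_Q]
        smooth_on_D[OF smooth_Q] assms] by simp
  finally show ?thesis by (simp add: metric_eq sum_divide_distrib[symmetric])
qed

text \<open>One more use of Euler's relation, now in degree 2, cancels the factor 1/2: the length of
  \<open>s\<close> measured by the metric at \<open>s\<close> is the Finsler length.\<close>

lemma metric_contract2:
  assumes "t \<in> U" "s \<noteq> 0"
  shows "(\<Sum>\<alpha>\<in>UNIV. \<Sum>\<beta>\<in>UNIV. s $ \<alpha> * s $ \<beta> * metric L \<alpha> \<beta> (t, s)) = Q (t, s)"
proof -
  have z: "(t, s) \<in> W" using assms by auto
  have "(\<Sum>\<alpha>\<in>UNIV. \<Sum>\<beta>\<in>UNIV. s $ \<alpha> * s $ \<beta> * metric L \<alpha> \<beta> (t, s))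
      = (\<Sum>\<alpha>\<in>UNIV. s $ \<alpha> * (D Q (t, s) (0, axis \<alpha> 1) / 2))"
    unfolding metric_contract[OF assms, symmetric] by (simp add: sum_distrib_left mult_ac)
  also have "\<dots> = D Q (t, s) (0, s) / 2"
    using linear_axis_sum[OF linear_snd_part[OF smooth_on_linear[OF smooth_Q z]], of s]
    by (simp add: sum_divide_distrib)
  also have "\<dots> = Q (t, s)"
    using euler_homogeneous[OF homogeneous_Q smooth_Q assms] by simp
  finally show ?thesis .
qed

lemma D_sum_scaled:
  assumes "\<And>i. i \<in> I \<Longrightarrow> f i differentiable at x"
  shows "(\<lambda>y. \<Sum>i\<in>I. c i * f i y :: real) differentiable at x"
    "D (\<lambda>y. \<Sum>i\<in>I. c i * f i y :: real) x v = (\<Sum>i\<in>I. c i * D (f i) x v)"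
proof -
  have d: "((\<lambda>y. \<Sum>i\<in>I. c i * f i y) has_derivative (\<lambda>v. \<Sum>i\<in>I. c i * D (f i) x v)) (at x)"
    by (intro has_derivative_sum has_derivative_mult_right differentiable_D assms)
  show "(\<lambda>y. \<Sum>i\<in>I. c i * f i y :: real) differentiable at x" using d by (auto simp: differentiable_def)
  show "D (\<lambda>y. \<Sum>i\<in>I. c i * f i y :: real) x v = (\<Sum>i\<in>I. c i * D (f i) x v)"
    by (simp add: has_derivative_D[OF d])
qed

text \<open>Contracting with a frozen \<open>s\<close> gives a different function on the bundle than
  \<open>metric_contract\<close>, but the two agree on the slice of constant \<open>s\<close>, which is all that
  \<open>partial_t\<close> sees.\<close>

lemma partial_t_metric_contract:
  assumes "t \<in> U" "s \<noteq> 0"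
  shows "(\<Sum>\<alpha>\<in>UNIV. s $ \<alpha> * partial_t \<beta> (metric L \<delta> \<alpha>) (t, s))
    = D2 Q (t, s) (0, axis \<delta> 1) (axis \<beta> 1, 0) / 2"
proof -
  have z: "(t, s) \<in> W" using assms by auto
  have dm: "metric L \<delta> \<alpha> differentiable at (t, s)" for \<alpha>
    by (rule smooth_on_differentiable[OF smooth_metric z])
  have dq: "(\<lambda>z. D Q z (0, axis \<delta> 1)) differentiable at (t, s)"
    by (rule smooth_on_differentiable[OF smooth_on_D[OF smooth_Q] z])
  have "(\<Sum>\<alpha>\<in>UNIV. s $ \<alpha> * partial_t \<beta> (metric L \<delta> \<alpha>) (t, s))
      = D (\<lambda>z. \<Sum>\<alpha>\<in>UNIV. s $ \<alpha> * metric L \<delta> \<alpha> z) (t, s) (axis \<beta> 1, 0)"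
    by (subst D_sum_scaled(2)) (auto intro: dm simp: partial_t_def)
  also have "\<dots> = D (\<lambda>z. (1/2) * D Q z (0, axis \<delta> 1)) (t, s) (axis \<beta> 1, 0)"
  proof (rule D_fst_cong[OF open_U assms(1)])
    show "(\<lambda>z. (1/2) * D Q z (0, axis \<delta> 1)) differentiable at (t, s)"
      by (intro differentiable_mult dq) auto
    show "(\<lambda>z. \<Sum>\<alpha>\<in>UNIV. s $ \<alpha> * metric L \<delta> \<alpha> z) differentiable at (t, s)"
      by (intro D_sum_scaled dm)
  qed (use metric_contract assms in auto)
  also have "\<dots> = D2 Q (t, s) (0, axis \<delta> 1) (axis \<beta> 1, 0) / 2"
    by (subst has_derivative_D[OF has_derivative_mult_right[OF differentiable_D[OF dq]]]) simp
  finally show ?thesis .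
qed

lemma partial_t_metric_contract2:
  assumes "t \<in> U" "s \<noteq> 0"
  shows "(\<Sum>\<alpha>\<in>UNIV. \<Sum>\<beta>\<in>UNIV. s $ \<alpha> * s $ \<beta> * partial_t \<delta> (metric L \<alpha> \<beta>) (t, s))
    = D Q (t, s) (axis \<delta> 1, 0)"
proof -
  have z: "(t, s) \<in> W" using assms by auto
  have dm: "metric L \<alpha> \<beta> differentiable at (t, s)" for \<alpha> \<beta>
    by (rule smooth_on_differentiable[OF smooth_metric z])
  \<comment> \<open>Flattening the double sum to a sum over pairs lets one application of
    \<open>D_sum_scaled\<close> differentiate it with \<open>s\<close> frozen in the
    coefficients.\<close>
  have "(\<Sum>\<alpha>\<in>UNIV. \<Sum>\<beta>\<in>UNIV. s $ \<alpha> * s $ \<beta> * partial_t \<delta> (metric L \<alpha> \<beta>) (t, s))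
    = (\<Sum>i\<in>UNIV. (s $ fst i * s $ snd i) * partial_t \<delta> (metric L (fst i) (snd i)) (t, s))"
    by (simp add: sum.cartesian_product case_prod_unfold)
  also have "\<dots> = D (\<lambda>z. \<Sum>i\<in>UNIV. (s $ fst i * s $ snd i) * metric L (fst i) (snd i) z) (t, s) (axis \<delta> 1, 0)"
    by (subst D_sum_scaled(2)) (auto intro: dm simp: partial_t_def)
  also have "\<dots> = D Q (t, s) (axis \<delta> 1, 0)"
  proof (rule D_fst_cong[OF open_U assms(1)])
    show "(\<lambda>z. \<Sum>i\<in>UNIV. (s $ fst i * s $ snd i) * metric L (fst i) (snd i) z) differentiable at (t, s)"
      by (intro D_sum_scaled dm)
    show "Q differentiable at (t, s)" by (rule smooth_on_differentiable[OF smooth_Q z])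
  qed (use metric_contract2 assms in \<open>simp add: sum.cartesian_product case_prod_unfold\<close>)
  finally show ?thesis .
qed

text \<open>Lowering the index removes the inverse metric from the spray. What remains is the
  acceleration-free part of the Euler--Lagrange expression of \<open>Q\<close>.\<close>

lemma metric_spray:
  assumes "t \<in> U" "s \<noteq> 0"
  shows "4 * (\<Sum>\<mu>\<in>UNIV. metric L \<delta> \<mu> (t, s) * spray L \<mu> (t, s))
    = D2 Q (t, s) (0, axis \<delta> 1) (s, 0) - D Q (t, s) (axis \<delta> 1, 0)"
proof -
  have z: "(t, s) \<in> W" using assms by auto
  \<comment> \<open>The bracket of the Christoffel symbol with lowered index, contracted twice with
    \<open>s\<close>.\<close>
  define c where "c \<epsilon> = (\<Sum>\<alpha>\<in>UNIV. \<Sum>\<beta>\<in>UNIV. (partial_t \<beta> (metric L \<epsilon> \<alpha>) (t, s)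
      + partial_t \<alpha> (metric L \<epsilon> \<beta>) (t, s) - partial_t \<epsilon> (metric L \<alpha> \<beta>) (t, s)) * s $ \<alpha> * s $ \<beta>)" for \<epsilon>
  \<comment> \<open>The factor 4 absorbs the 1/2 of the spray and the 1/2 of the Christoffel
    symbol.\<close>
  have sp: "4 * spray L \<mu> (t, s) = (\<Sum>\<epsilon>\<in>UNIV. metric_inv L \<mu> \<epsilon> (t, s) * c \<epsilon>)" for \<mu>
  proof -
    have "spray L \<mu> (t, s) = 1/2 * (\<Sum>\<alpha>\<in>UNIV. \<Sum>\<beta>\<in>UNIV. \<Sum>\<epsilon>\<in>UNIV. metric_inv L \<mu> \<epsilon> (t, s) / 2 *
      ((partial_t \<beta> (metric L \<epsilon> \<alpha>) (t, s)
      + partial_t \<alpha> (metric L \<epsilon> \<beta>) (t, s) - partial_t \<epsilon> (metric L \<alpha> \<beta>) (t, s)) * s $ \<alpha> * s $ \<beta>))"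
      by (simp add: spray_def christoffel_def sum_distrib_right mult.assoc)
    also have "\<dots> = 1/2 * (\<Sum>\<epsilon>\<in>UNIV. \<Sum>\<alpha>\<in>UNIV. \<Sum>\<beta>\<in>UNIV. metric_inv L \<mu> \<epsilon> (t, s) / 2 *
      ((partial_t \<beta> (metric L \<epsilon> \<alpha>) (t, s)
      + partial_t \<alpha> (metric L \<epsilon> \<beta>) (t, s) - partial_t \<epsilon> (metric L \<alpha> \<beta>) (t, s)) * s $ \<alpha> * s $ \<beta>))"
      by (subst sum.swap[where A=UNIV and B=UNIV, symmetric]) (subst (2) sum.swap, rule refl)
    also have "\<dots> = 1/2 * (\<Sum>\<epsilon>\<in>UNIV. metric_inv L \<mu> \<epsilon> (t, s) / 2 * c \<epsilon>)"
      by (simp only: c_def sum_distrib_left)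
    finally show ?thesis by (simp add: sum_distrib_left sum_divide_distrib)
  qed
  have "4 * (\<Sum>\<mu>\<in>UNIV. metric L \<delta> \<mu> (t, s) * spray L \<mu> (t, s))
      = (\<Sum>\<mu>\<in>UNIV. metric L \<delta> \<mu> (t, s) * (4 * spray L \<mu> (t, s)))"
    by (simp add: sum_distrib_left mult.left_commute)
  also have "\<dots> = (\<Sum>\<mu>\<in>UNIV. \<Sum>\<epsilon>\<in>UNIV. metric L \<delta> \<mu> (t, s) * metric_inv L \<mu> \<epsilon> (t, s) * c \<epsilon>)"
    unfolding sp by (simp add: sum_distrib_left mult.assoc)
  also have "\<dots> = (\<Sum>\<epsilon>\<in>UNIV. (\<Sum>\<mu>\<in>UNIV. metric L \<delta> \<mu> (t, s) * metric_inv L \<mu> \<epsilon> (t, s)) * c \<epsilon>)"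
    by (subst sum.swap) (simp add: sum_distrib_right)
  also have "\<dots> = c \<delta>"
    unfolding metric_metric_inv[OF z] if_distrib[of "\<lambda>x. x * c _"] by (simp cong: if_cong)
  \<comment> \<open>The first two terms of the bracket coincide after exchanging the summation
    indices. Their factor 2 cancels the 1/2 from \<open>partial_t_metric_contract\<close>.\<close>
  also have "\<dots> = 2 * (\<Sum>\<beta>\<in>UNIV. s $ \<beta> * (\<Sum>\<alpha>\<in>UNIV. s $ \<alpha> * partial_t \<beta> (metric L \<delta> \<alpha>) (t, s)))
      - (\<Sum>\<alpha>\<in>UNIV. \<Sum>\<beta>\<in>UNIV. s $ \<alpha> * s $ \<beta> * partial_t \<delta> (metric L \<alpha> \<beta>) (t, s))"
  proof -
    have sw: "(\<Sum>\<alpha>\<in>UNIV. \<Sum>\<beta>\<in>UNIV. s $ \<alpha> * s $ \<beta> * partial_t \<beta> (metric L \<delta> \<alpha>) (t, s))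
      = (\<Sum>\<beta>\<in>UNIV. s $ \<beta> * (\<Sum>\<alpha>\<in>UNIV. s $ \<alpha> * partial_t \<beta> (metric L \<delta> \<alpha>) (t, s)))"
      by (subst sum.swap) (simp add: sum_distrib_left mult_ac)
    have sw': "(\<Sum>\<alpha>\<in>UNIV. \<Sum>\<beta>\<in>UNIV. s $ \<alpha> * s $ \<beta> * partial_t \<alpha> (metric L \<delta> \<beta>) (t, s))
      = (\<Sum>\<beta>\<in>UNIV. s $ \<beta> * (\<Sum>\<alpha>\<in>UNIV. s $ \<alpha> * partial_t \<beta> (metric L \<delta> \<alpha>) (t, s)))"
      by (simp add: sum_distrib_left mult_ac)
    have "c \<delta> = (\<Sum>\<alpha>\<in>UNIV. \<Sum>\<beta>\<in>UNIV. s $ \<alpha> * s $ \<beta> * partial_t \<beta> (metric L \<delta> \<alpha>) (t, s))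
      + (\<Sum>\<alpha>\<in>UNIV. \<Sum>\<beta>\<in>UNIV. s $ \<alpha> * s $ \<beta> * partial_t \<alpha> (metric L \<delta> \<beta>) (t, s))
      - (\<Sum>\<alpha>\<in>UNIV. \<Sum>\<beta>\<in>UNIV. s $ \<alpha> * s $ \<beta> * partial_t \<delta> (metric L \<alpha> \<beta>) (t, s))"
      unfolding c_def sum.distrib[symmetric] sum_subtractf[symmetric]
      by (intro sum.cong refl) (simp add: algebra_simps)
    then show ?thesis unfolding sw sw' by simp
  qed
  also have "\<dots> = (\<Sum>\<beta>\<in>UNIV. s $ \<beta> * D2 Q (t, s) (0, axis \<delta> 1) (axis \<beta> 1, 0)) - D Q (t, s) (axis \<delta> 1, 0)"
    unfolding partial_t_metric_contract[OF assms] partial_t_metric_contract2[OF assms]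
    by (simp add: sum_divide_distrib[symmetric])
  also have "(\<Sum>\<beta>\<in>UNIV. s $ \<beta> * D2 Q (t, s) (0, axis \<delta> 1) (axis \<beta> 1, 0)) = D2 Q (t, s) (0, axis \<delta> 1) (s, 0)"
    using linear_axis_sum[OF linear_fst_part[OF linear_D2_right[OF z smooth_Q]], of "(0, axis \<delta> 1)" s] by simp
  finally show ?thesis .
qed

text \<open>Read \<open>s\<close> and \<open>a\<close> as velocity and acceleration of a curve: the left-hand side is the
  Euler--Lagrange equation of \<open>Q\<close>.\<close>

lemma euler_lagrange_iff:
  assumes "t \<in> U" "s \<noteq> 0"
  shows "(\<forall>w. D2 Q (t, s) (0, w) (s, a) = D Q (t, s) (w, 0)) \<longleftrightarrow> (\<forall>\<alpha>. a $ \<alpha> = - 2 * spray L \<alpha> (t, s))"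
proof -
  have z: "(t, s) \<in> W" using assms by auto
  have lin: "linear (D2 Q (t, s) v)" for v by (rule linear_D2_right[OF z smooth_Q])
  \<comment> \<open>The failure of the spray equation. The two sides of the Euler--Lagrange equation
    differ by twice the metric applied to \<open>b\<close>, so nondegeneracy of the metric gives the
    equivalence.\<close>
  define b where "b = (\<chi> \<alpha>. a $ \<alpha> + 2 * spray L \<alpha> (t, s))"
  have m: "2 * (\<Sum>\<mu>\<in>UNIV. metric L \<delta> \<mu> (t, s) * a $ \<mu>) = D2 Q (t, s) (0, axis \<delta> 1) (0, a)" for \<delta>
    using linear_axis_sum[OF linear_snd_part[OF lin], of "(0, axis \<delta> 1)" a]
    by (simp add: metric_alt[OF z] sum_divide_distrib[symmetric] mult.commute)
  have e: "D2 Q (t, s) (0, axis \<delta> 1) (s, a) - D Q (t, s) (axis \<delta> 1, 0)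
      = 2 * (\<Sum>\<mu>\<in>UNIV. metric L \<delta> \<mu> (t, s) * b $ \<mu>)" for \<delta>
  proof -
    have "2 * (\<Sum>\<mu>\<in>UNIV. metric L \<delta> \<mu> (t, s) * b $ \<mu>)
      = 2 * (\<Sum>\<mu>\<in>UNIV. metric L \<delta> \<mu> (t, s) * a $ \<mu>) + 4 * (\<Sum>\<mu>\<in>UNIV. metric L \<delta> \<mu> (t, s) * spray L \<mu> (t, s))"
      by (simp add: b_def algebra_simps sum.distrib sum_distrib_left)
    then show ?thesis unfolding m metric_spray[OF assms] using linear_Pair_split[OF lin, of "(0, axis \<delta> 1)" s a] by simp
  qed
  have "(\<forall>\<delta>. D2 Q (t, s) (0, axis \<delta> 1) (s, a) = D Q (t, s) (axis \<delta> 1, 0)) \<longleftrightarrow>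
      (\<forall>\<delta>. (\<Sum>\<mu>\<in>UNIV. metric L \<delta> \<mu> (t, s) * b $ \<mu>) = 0)"
    by (subst eq_iff_diff_eq_0, subst e) simp
  also have "\<dots> \<longleftrightarrow> b = 0" using metric_kernel[OF z] by auto
  also have "\<dots> \<longleftrightarrow> (\<forall>\<alpha>. a $ \<alpha> = - 2 * spray L \<alpha> (t, s))"
    by (simp add: b_def vec_eq_iff add_eq_0_iff2)
  finally show ?thesis
    using linear_eq_iff_axis[OF linear_snd_part[OF linear_D2_left[OF open_W z smooth_Q]]
        linear_fst_part[OF smooth_on_linear[OF smooth_Q z]], of "(s, a)"] by simp
qed

end

section \<open>Local solutions of differential equations\<close>

text \<open>Each directional derivative along a basis vector is continuous, hence bounded on the
  compact ball; the sum of these bounds controls the operator norm. Convexity of the ball then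
  permits the mean value inequality.\<close>

lemma smooth_on_lipschitz_cball:
  fixes f :: "'a::euclidean_space \<Rightarrow> 'b::euclidean_space"
  assumes sm: "smooth_on W f" and sub: "cball x r \<subseteq> W"
  shows "\<exists>K\<ge>0. \<forall>y\<in>cball x r. \<forall>z\<in>cball x r. norm (f y - f z) \<le> K * norm (y - z)"
proof -
  have "\<exists>k. \<forall>z\<in>cball x r. norm (D f z b) \<le> k" for b
  proof -
    have "compact ((\<lambda>z. D f z b) ` cball x r)"
      using smooth_on_continuous_on[OF smooth_on_D[OF sm]] sub
      by (intro compact_continuous_image) (auto intro: continuous_on_subset)
    from compact_imp_bounded[OF this] show ?thesis by (auto simp: bounded_iff)
  qed
  then obtain k where k: "\<And>b z. z \<in> cball x r \<Longrightarrow> norm (D f z b) \<le> k b" by metis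
  have on: "onorm (D f z) \<le> (\<Sum>b\<in>Basis. \<bar>k b\<bar>)" if z: "z \<in> cball x r" for z
  proof (rule onorm_bound)
    show "0 \<le> (\<Sum>b\<in>Basis. \<bar>k b\<bar>)" by (simp add: sum_nonneg)
    fix v :: 'a
    have "norm (D f z v) = norm (\<Sum>b\<in>Basis. (v \<bullet> b) *\<^sub>R D f z b)"
      using D_euclidean[OF smooth_on_linear[OF sm], of z v] z sub by auto
    also have "\<dots> \<le> (\<Sum>b\<in>Basis. norm v * \<bar>k b\<bar>)"
    proof (rule sum_norm_le)
      fix b :: 'a assume b: "b \<in> Basis"
      have "\<bar>v \<bullet> b\<bar> * norm (D f z b) \<le> norm v * \<bar>k b\<bar>"
        using k[OF z, of b] by (intro mult_mono Basis_le_norm[OF b]) auto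
      then show "norm ((v \<bullet> b) *\<^sub>R D f z b) \<le> norm v * \<bar>k b\<bar>" by simp
    qed
    finally show "norm (D f z v) \<le> (\<Sum>b\<in>Basis. \<bar>k b\<bar>) * norm v"
      by (simp add: sum_distrib_left mult.commute)
  qed
  have "norm (f y - f z) \<le> (\<Sum>b\<in>Basis. \<bar>k b\<bar>) * norm (y - z)"
    if "y \<in> cball x r" "z \<in> cball x r" for y z
    by (rule differentiable_bound[OF convex_cball _ on that])
      (use sub smooth_on_has_derivative[OF sm] in \<open>blast intro: has_derivative_at_withinI\<close>)
  then show ?thesis by (intro exI[of _ "\<Sum>b\<in>Basis. \<bar>k b\<bar>"]) (auto simp: sum_nonneg)
qed

text \<open>Banach's fixed point theorem for the integral operator, a contraction because
  \<open>K * d < 1\<close>. The bound by \<open>M * d\<close> is part of the conclusion so that a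
  localized field can be compared with its global extension.\<close>

lemma picard_global:
  fixes f :: "'a::euclidean_space \<Rightarrow> 'a"
  assumes lip: "\<And>y z. norm (f y - f z) \<le> K * norm (y - z)" and K: "0 \<le> K"
    and bound: "\<And>y. norm (f y) \<le> M" and d: "0 < d" "K * d < 1"
  shows "\<exists>z. z 0 = z0 \<and> (\<forall>\<tau>\<in>{0..d}. norm (z \<tau> - z0) \<le> M * d \<and>
    (z has_vector_derivative f (z \<tau>)) (at \<tau> within {0..d}))"
proof -
  \<comment> \<open>The function space consists of bounded continuous functions on the whole line,
    so time is clamped to \<open>{0..d}\<close> before integrating.\<close>
  define c where "c \<tau> = max 0 (min d \<tau>)" for \<tau> :: real
  have c: "c \<tau> \<in> {0..d}" "continuous_on UNIV c" for \<tau>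
    unfolding c_def using d by (auto intro!: continuous_intros)
  define G where "G u \<tau> = z0 + integral {0..c \<tau>} (\<lambda>\<sigma>. f (apply_bcontfun u \<sigma>))" for u \<tau>
  have fc: "continuous_on UNIV f"
    by (rule lipschitz_on_continuous_on[of K]) (use lip K in \<open>auto simp: lipschitz_on_def dist_norm\<close>)
  have fu: "continuous_on S (\<lambda>\<sigma>. f (apply_bcontfun u \<sigma>))" for u S
    using continuous_on_compose2[OF fc continuous_on_apply_bcontfun] by auto
  have M: "0 \<le> M" using bound[of 0] norm_ge_zero order_trans by blast
  have Gb: "norm (G u \<tau> - z0) \<le> M * d" for u \<tau>
  proof -
    have "norm (integral {0..c \<tau>} (\<lambda>\<sigma>. f (apply_bcontfun u \<sigma>))) \<le> M * (c \<tau> - 0)"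
      by (rule integral_bound) (use c bound fu in auto)
    also have "\<dots> \<le> M * d" using c(1)[of \<tau>] M by (simp add: mult_left_mono)
    finally show ?thesis by (simp add: G_def)
  qed
  have Gc: "continuous_on UNIV (G u)" for u
  proof -
    have "continuous_on {0..d} (\<lambda>x. integral {0..x} (\<lambda>\<sigma>. f (apply_bcontfun u \<sigma>)))"
      by (intro indefinite_integral_continuous_1 integrable_continuous_real fu)
    then have "continuous_on UNIV (\<lambda>x. integral {0..c x} (\<lambda>\<sigma>. f (apply_bcontfun u \<sigma>)))"
      by (rule continuous_on_compose2[OF _ c(2)]) (use c(1) in blast)
    then show ?thesis
      unfolding G_def[abs_def] by (intro continuous_on_add continuous_on_const)
  qed
  have Gin: "G u \<in> bcontfun" for u
  proof (rule bcontfun_normI[OF Gc])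
    fix \<tau>
    show "norm (G u \<tau>) \<le> norm z0 + M * d"
      using Gb[of u \<tau>] norm_triangle_ineq[of "G u \<tau> - z0" z0] by simp
  qed
  define T where "T u = Bcontfun (G u)" for u
  have T: "apply_bcontfun (T u) = G u" for u
    unfolding T_def using Bcontfun_inverse[OF Gin] .
  have "dist (T u) (T v) \<le> (K * d) * dist u v" for u v
  proof (rule dist_bound)
    fix \<tau>
    have int: "(\<lambda>\<sigma>. f (apply_bcontfun u \<sigma>)) integrable_on {0..c \<tau>}" for u
      by (intro integrable_continuous_real fu)
    have "dist (T u \<tau>) (T v \<tau>)
        = norm (integral {0..c \<tau>} (\<lambda>\<sigma>. f (apply_bcontfun u \<sigma>) - f (apply_bcontfun v \<sigma>)))"
      by (simp add: T G_def dist_norm integral_diff[OF int int])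
    also have "\<dots> \<le> (K * dist u v) * (c \<tau> - 0)"
    proof (rule integral_bound)
      show "continuous_on {0..c \<tau>} (\<lambda>\<sigma>. f (apply_bcontfun u \<sigma>) - f (apply_bcontfun v \<sigma>))"
        by (intro continuous_on_diff fu)
      fix \<sigma>
      have "norm (f (apply_bcontfun u \<sigma>) - f (apply_bcontfun v \<sigma>)) \<le> K * dist (apply_bcontfun u \<sigma>) (apply_bcontfun v \<sigma>)"
        using lip by (simp add: dist_norm)
      also have "\<dots> \<le> K * dist u v" using K dist_bounded by (intro mult_left_mono) auto
      finally show "norm (f (apply_bcontfun u \<sigma>) - f (apply_bcontfun v \<sigma>)) \<le> K * dist u v" .
    qed (use c in auto)
    also have "\<dots> \<le> (K * dist u v) * d" using c(1)[of \<tau>] K by (intro mult_left_mono) auto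
    finally show "dist (T u \<tau>) (T v \<tau>) \<le> K * d * dist u v" by (simp add: mult_ac)
  qed
  then have "\<exists>!u. T u = u" using K d by (intro banach_fix_type[of "K * d"]) auto
  then obtain u where u: "T u = u" by blast
  then have uG: "apply_bcontfun u = G u" using T by metis
  have "apply_bcontfun u 0 = z0"
    using fun_cong[OF uG, of 0] d by (simp add: G_def c_def)
  moreover have "(apply_bcontfun u has_vector_derivative f (apply_bcontfun u \<tau>)) (at \<tau> within {0..d})"
    if \<tau>: "\<tau> \<in> {0..d}" for \<tau>
  proof -
    have "((\<lambda>x. z0 + integral {0..x} (\<lambda>\<sigma>. f (apply_bcontfun u \<sigma>))) has_vector_derivative
        0 + f (apply_bcontfun u \<tau>)) (at \<tau> within {0..d})"
      by (intro has_vector_derivative_add has_vector_derivative_const integral_has_vector_derivative fu \<tau>)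
    then have "((\<lambda>x. z0 + integral {0..x} (\<lambda>\<sigma>. f (apply_bcontfun u \<sigma>))) has_vector_derivative
        f (apply_bcontfun u \<tau>)) (at \<tau> within {0..d})" by simp
    then show ?thesis
      by (rule has_vector_derivative_transform[OF \<tau>, rotated])
        (subst fun_cong[OF uG], auto simp: G_def c_def)
  qed
  ultimately show ?thesis using Gb uG by (intro exI[of _ "apply_bcontfun u"]) metis
qed

text \<open>Precomposing with the closest-point projection onto a ball extends the field to a
  bounded, globally Lipschitz one, since the projection does not increase distances. The solution
  stays in the ball, where nothing was changed.\<close>

lemma picard_local:
  fixes f :: "'a::euclidean_space \<Rightarrow> 'a"
  assumes W: "open W" "z0 \<in> W" and sm: "smooth_on W f"
  shows "\<exists>d>0. \<exists>z. z 0 = z0 \<and> (\<forall>\<tau>\<in>{0..d}. z \<tau> \<in> W \<and>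
    (z has_vector_derivative f (z \<tau>)) (at \<tau> within {0..d}))"
proof -
  obtain r where r: "r > 0" "cball z0 r \<subseteq> W"
    using W open_contains_cball by blast
  obtain K where K: "K \<ge> 0" "\<And>y z. y \<in> cball z0 r \<Longrightarrow> z \<in> cball z0 r \<Longrightarrow> norm (f y - f z) \<le> K * norm (y - z)"
    using smooth_on_lipschitz_cball[OF sm r(2)] by blast
  have "compact (f ` cball z0 r)"
    using smooth_on_continuous_on[OF sm] r(2)
    by (intro compact_continuous_image) (auto intro: continuous_on_subset)
  then obtain M where M: "\<And>y. y \<in> cball z0 r \<Longrightarrow> norm (f y) \<le> M"
    using compact_imp_bounded bounded_iff by (metis imageI)
  have M0: "0 \<le> M" using M[of z0] r norm_ge_zero order_trans by (metis centre_in_cball less_imp_le)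
  let ?p = "closest_point (cball z0 r)"
  have p: "?p y \<in> cball z0 r" for y
    using r by (intro closest_point_in_set) auto
  \<comment> \<open>The first bound gives \<open>M * d \<le> r\<close>, so the solution cannot leave
    the ball; the second gives the contraction constant. Adding 1 keeps the denominators
    positive.\<close>
  define d where "d = min (r / (M + 1)) (1 / (K + 1))"
  have d: "0 < d" using r M0 K by (simp add: d_def)
  have Md: "M * d \<le> r"
  proof -
    have "M * d \<le> (M + 1) * (r / (M + 1))"
      using M0 d r by (intro mult_mono) (auto simp: d_def)
    then show ?thesis using M0 by simp
  qed
  have Kd: "K * d < 1"
  proof -
    have "K * d \<le> K * (1 / (K + 1))"
      using K by (intro mult_left_mono) (auto simp: d_def)
    also have "\<dots> < 1" using K by (simp add: divide_simps)
    finally show ?thesis .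
  qed
  have lip: "norm ((f \<circ> ?p) y - (f \<circ> ?p) z) \<le> K * norm (y - z)" for y z
  proof -
    have "norm (f (?p y) - f (?p z)) \<le> K * norm (?p y - ?p z)"
      by (rule K(2)[OF p p])
    also have "\<dots> \<le> K * norm (y - z)"
      using closest_point_lipschitz[of "cball z0 r" y z] K r
      by (intro mult_left_mono) (auto simp: dist_norm)
    finally show ?thesis by simp
  qed
  obtain z where z: "z 0 = z0" "\<And>\<tau>. \<tau> \<in> {0..d} \<Longrightarrow> norm (z \<tau> - z0) \<le> M * d"
    "\<And>\<tau>. \<tau> \<in> {0..d} \<Longrightarrow> (z has_vector_derivative (f \<circ> ?p) (z \<tau>)) (at \<tau> within {0..d})"
    using picard_global[OF lip K(1) _ d Kd, of M z0] M[OF p] by auto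
  have "z \<tau> \<in> cball z0 r" if "\<tau> \<in> {0..d}" for \<tau>
    using z(2)[OF that] Md by (simp add: dist_norm norm_minus_commute)
  then have "z \<tau> \<in> W \<and> (z has_vector_derivative f (z \<tau>)) (at \<tau> within {0..d})" if "\<tau> \<in> {0..d}" for \<tau>
    using z(3)[OF that] that r(2) closest_point_self by (metis comp_apply subsetD)
  then show ?thesis using d z(1) by blast
qed

section \<open>Derivatives along curves\<close>

text \<open>Chain rule for a direction that moves along with the curve. It yields accelerations of
  image curves as well as the rate of change of the fibre derivative of \<open>Q\<close> paired with
  a moving vector.\<close>

lemma has_vector_derivative_D_apply:
  fixes f :: "'a::euclidean_space \<Rightarrow> 'b::euclidean_space"
  assumes S: "open S" "x \<tau> \<in> S" and sm: "smooth_on S f"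
    and x: "(x has_vector_derivative x') (at \<tau> within I)"
    and u: "(u has_vector_derivative u') (at \<tau> within I)"
  shows "((\<lambda>\<sigma>. D f (x \<sigma>) (u \<sigma>)) has_vector_derivative D2 f (x \<tau>) (u \<tau>) x' + D f (x \<tau>) u') (at \<tau> within I)"
proof -
  let ?h = "\<lambda>z. D2 f (x \<tau>) (u \<tau>) (fst z) + D f (x \<tau>) (snd z)"
  have "((\<lambda>\<sigma>. (x \<sigma>, u \<sigma>)) has_derivative (\<lambda>h. (h *\<^sub>R x', h *\<^sub>R u'))) (at \<tau> within I)"
    using x u unfolding has_vector_derivative_def by (rule has_derivative_Pair)
  from has_derivative_compose[OF this has_derivative_D_apply[OF S sm]]
  have d: "((\<lambda>\<sigma>. D f (x \<sigma>) (u \<sigma>)) has_derivative (\<lambda>h. ?h (h *\<^sub>R x', h *\<^sub>R u'))) (at \<tau> within I)"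
    by simp
  have "(\<lambda>h. ?h (h *\<^sub>R x', h *\<^sub>R u')) = (\<lambda>h. h *\<^sub>R (D2 f (x \<tau>) (u \<tau>) x' + D f (x \<tau>) u'))"
    using linear_cmul[OF smooth_on_linear[OF sm S(2)]] linear_cmul[OF linear_D2_right[OF S(2) sm]]
    by (simp add: scaleR_add_right)
  with d show ?thesis by (simp add: has_vector_derivative_def)
qed

lemma has_vector_derivative_D_comp:
  fixes f :: "'a::euclidean_space \<Rightarrow> 'b::euclidean_space"
  assumes "f differentiable at (x \<tau>)" and x: "(x has_vector_derivative x') (at \<tau> within I)"
  shows "((\<lambda>\<sigma>. f (x \<sigma>)) has_vector_derivative D f (x \<tau>) x') (at \<tau> within I)"
proof -
  have d: "((\<lambda>\<sigma>. f (x \<sigma>)) has_derivative (\<lambda>h. D f (x \<tau>) (h *\<^sub>R x'))) (at \<tau> within I)"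
    using x unfolding has_vector_derivative_def
    by (rule has_derivative_compose[where g=f and f=x, OF _ differentiable_D[OF assms(1)]])
  then show ?thesis
    using linear_cmul[OF has_derivative_linear[OF differentiable_D[OF assms(1)]]]
    by (simp add: has_vector_derivative_def)
qed

lemma has_vector_derivative_cong_open:
  assumes "(f has_vector_derivative f') (at \<tau> within I)" "open T" "\<tau> \<in> T" "\<tau> \<in> I"
    and "\<And>\<sigma>. \<sigma> \<in> T \<Longrightarrow> \<sigma> \<in> I \<Longrightarrow> g \<sigma> = f \<sigma>"
  shows "(g has_vector_derivative f') (at \<tau> within I)"
proof -
  obtain d where "d > 0" "\<And>\<sigma>. dist \<sigma> \<tau> < d \<Longrightarrow> \<sigma> \<in> T"
    using assms(2,3) unfolding open_dist by blast
  then show ?thesis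
    by (intro has_vector_derivative_transform_within[OF assms(1)]) (auto simp: assms(4,5))
qed

lemma velocityI:
  assumes "a < b" "\<tau> \<in> {a..b}" "(x has_vector_derivative v) (at \<tau> within {a..b})"
  shows "velocity a b x \<tau> = v"
  unfolding velocity_def using vector_derivative_within_closed_interval[OF assms] .

lemma has_vector_derivative_velocity:
  "x differentiable (at \<tau> within {a..b}) \<Longrightarrow> (x has_vector_derivative velocity a b x \<tau>) (at \<tau> within {a..b})"
  unfolding velocity_def using vector_derivative_works by blast

text \<open>The set \<open>T\<close> records where the coordinate curve is meaningful. An open
  \<open>T\<close> supplies the neighbourhood on which the velocity is known before it is
  differentiated again; a singleton expresses the pointwise condition.\<close>

definition regular_at :: "real \<Rightarrow> real \<Rightarrow> real set \<Rightarrow> (real \<Rightarrow> real ^ 'p::finite) \<Rightarrow> bool" where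
  "regular_at a b T x \<longleftrightarrow> (\<forall>\<sigma>\<in>T \<inter> {a..b}. x differentiable (at \<sigma> within {a..b}) \<and>
     velocity a b x differentiable (at \<sigma> within {a..b}))"

lemma velocity_image:
  fixes f :: "real ^ 'p::finite \<Rightarrow> real ^ 'n::finite"
  assumes ab: "a < b" and T: "open T" and reg: "regular_at a b T x"
    and S: "open S" and sm: "smooth_on S f"
    and y: "\<And>\<sigma>. \<sigma> \<in> T \<inter> {a..b} \<Longrightarrow> x \<sigma> \<in> S \<and> y \<sigma> = f (x \<sigma>)"
  shows "regular_at a b T y"
    and "\<And>\<tau>. \<tau> \<in> T \<inter> {a..b} \<Longrightarrow> velocity a b y \<tau> = D f (x \<tau>) (velocity a b x \<tau>)"
    and "\<And>\<tau>. \<tau> \<in> T \<inter> {a..b} \<Longrightarrow> velocity a b (velocity a b y) \<tau> =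
      D2 f (x \<tau>) (velocity a b x \<tau>) (velocity a b x \<tau>) + D f (x \<tau>) (velocity a b (velocity a b x) \<tau>)"
proof -
  have x: "(x has_vector_derivative velocity a b x \<tau>) (at \<tau> within {a..b})"
    "(velocity a b x has_vector_derivative velocity a b (velocity a b x) \<tau>) (at \<tau> within {a..b})"
    if "\<tau> \<in> T \<inter> {a..b}" for \<tau>
    using reg that by (auto simp: regular_at_def intro!: has_vector_derivative_velocity)
  have 1: "(y has_vector_derivative D f (x \<tau>) (velocity a b x \<tau>)) (at \<tau> within {a..b})"
    if \<tau>: "\<tau> \<in> T \<inter> {a..b}" for \<tau>
  proof (rule has_vector_derivative_cong_open[OF _ T])
    show "((\<lambda>\<sigma>. f (x \<sigma>)) has_vector_derivative D f (x \<tau>) (velocity a b x \<tau>)) (at \<tau> within {a..b})"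
      by (intro has_vector_derivative_D_comp x \<tau> smooth_on_differentiable[OF sm]) (use y \<tau> in blast)
  qed (use y \<tau> in blast)+
  show v: "velocity a b y \<tau> = D f (x \<tau>) (velocity a b x \<tau>)" if \<tau>: "\<tau> \<in> T \<inter> {a..b}" for \<tau>
    using velocityI[OF ab _ 1[OF \<tau>]] \<tau> by auto
  \<comment> \<open>The velocity formula holds at every parameter of \<open>T\<close> in the
    interval, hence on a relative neighbourhood of \<open>\<tau>\<close>, and may be
    differentiated.\<close>
  have 2: "(velocity a b y has_vector_derivative
      D2 f (x \<tau>) (velocity a b x \<tau>) (velocity a b x \<tau>) + D f (x \<tau>) (velocity a b (velocity a b x) \<tau>))
      (at \<tau> within {a..b})"
    if \<tau>: "\<tau> \<in> T \<inter> {a..b}" for \<tau>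
  proof (rule has_vector_derivative_cong_open[OF _ T])
    show "((\<lambda>\<sigma>. D f (x \<sigma>) (velocity a b x \<sigma>)) has_vector_derivative
      D2 f (x \<tau>) (velocity a b x \<tau>) (velocity a b x \<tau>) + D f (x \<tau>) (velocity a b (velocity a b x) \<tau>))
      (at \<tau> within {a..b})"
      by (intro has_vector_derivative_D_apply[OF S _ sm] x \<tau>) (use y \<tau> in blast)
  qed (use v \<tau> in blast)+
  show "velocity a b (velocity a b y) \<tau> =
      D2 f (x \<tau>) (velocity a b x \<tau>) (velocity a b x \<tau>) + D f (x \<tau>) (velocity a b (velocity a b x) \<tau>)"
    if \<tau>: "\<tau> \<in> T \<inter> {a..b}" for \<tau>
    using velocityI[OF ab _ 2[OF \<tau>]] \<tau> by auto
  show "regular_at a b T y"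
    unfolding regular_at_def using 1 2 differentiableI_vector by blast
qed

section \<open>Charts\<close>

abbreviation rep_dom ::
  "('a, 'p::finite) chart \<Rightarrow> ('b, 'n::finite) chart \<Rightarrow> ('a \<Rightarrow> 'b) \<Rightarrow> (real ^ 'p) set" where
  "rep_dom c d \<phi> \<equiv> coord c ` (domain c \<inter> \<phi> -` domain d)"

lemma smooth_manifold_is_chart: "smooth_manifold X A \<Longrightarrow> c \<in> A \<Longrightarrow> is_chart X c"
  by (simp add: smooth_manifold_def)

lemma is_chart_domain_subset: "is_chart X c \<Longrightarrow> domain c \<subseteq> topspace X"
  by (simp add: is_chart_def openin_subset)

lemma smooth_manifold_cover:
  "smooth_manifold X A \<Longrightarrow> x \<in> topspace X \<Longrightarrow> \<exists>c\<in>A. x \<in> domain c"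
  by (auto simp: smooth_manifold_def)

lemma is_chart_inj:
  assumes "is_chart X c"
  shows "inj_on (coord c) (domain c)"
proof -
  have "topspace (subtopology X (domain c)) = domain c"
    using is_chart_domain_subset[OF assms] by (simp add: Int_absorb1)
  moreover have "inj_on (coord c) (topspace (subtopology X (domain c)))"
    using assms by (intro homeomorphic_imp_injective_map) (auto simp: is_chart_def)
  ultimately show ?thesis by simp
qed

lemma point_of_coord [simp]: "is_chart X c \<Longrightarrow> x \<in> domain c \<Longrightarrow> point_of c (coord c x) = x"
  unfolding point_of_def by (rule inv_into_f_f[OF is_chart_inj])

lemma coord_point_of: "t \<in> coord c ` domain c \<Longrightarrow> coord c (point_of c t) = t"
  unfolding point_of_def by (rule f_inv_into_f)

lemma point_of_in_domain: "t \<in> coord c ` domain c \<Longrightarrow> point_of c t \<in> domain c"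
  unfolding point_of_def by (rule inv_into_into)

lemma open_coord_image:
  assumes c: "is_chart X c" and V: "openin X V"
  shows "open (coord c ` (domain c \<inter> V))"
proof -
  have "open_map (subtopology X (domain c)) (top_of_set (coord c ` domain c)) (coord c)"
    using c by (simp add: is_chart_def homeomorphic_eq_everything_map)
  moreover have "openin (subtopology X (domain c)) (domain c \<inter> V)"
    using V by (auto simp: openin_subtopology)
  ultimately have "openin (top_of_set (coord c ` domain c)) (coord c ` (domain c \<inter> V))"
    by (auto simp: open_map_def)
  then show ?thesis using c openin_open_trans by (auto simp: is_chart_def)
qed

lemma continuous_map_point_of:
  assumes c: "is_chart X c"
  shows "continuous_map (top_of_set (coord c ` domain c)) X (point_of c)"
proof -
  obtain g where g: "homeomorphic_maps (subtopology X (domain c)) (top_of_set (coord c ` domain c)) (coord c) g"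
    using c by (auto simp: is_chart_def homeomorphic_map_maps)
  have "topspace (subtopology X (domain c)) = domain c"
    using is_chart_domain_subset[OF c] by auto
  with g have gc: "g (coord c x) = x" if "x \<in> domain c" for x
    using that by (simp add: homeomorphic_maps_def)
  have "continuous_map (top_of_set (coord c ` domain c)) X g"
    using g by (simp add: homeomorphic_maps_def continuous_map_in_subtopology)
  then show ?thesis
    by (rule continuous_map_eq) (use gc c in auto)
qed

lemma openin_rep_dom_preimage:
  assumes "smooth_map X A Y B \<phi>" "is_chart X c" "is_chart Y d"
  shows "openin X (domain c \<inter> \<phi> -` domain d)"
proof -
  have "openin X {x \<in> topspace X. \<phi> x \<in> domain d}"
    using assms by (intro openin_continuous_map_preimage) (auto simp: smooth_map_def is_chart_def)
  then have "openin X (domain c \<inter> {x \<in> topspace X. \<phi> x \<in> domain d})"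
    using assms(2) by (auto simp: is_chart_def)
  moreover have "domain c \<inter> {x \<in> topspace X. \<phi> x \<in> domain d} = domain c \<inter> \<phi> -` domain d"
    using is_chart_domain_subset[OF assms(2)] by auto
  ultimately show ?thesis by simp
qed

lemma open_rep_dom:
  assumes "smooth_map X A Y B \<phi>" "is_chart X c" "is_chart Y d"
  shows "open (rep_dom c d \<phi>)"
  using open_coord_image[OF assms(2) openin_rep_dom_preimage[OF assms]] by simp

lemma smooth_local_rep:
  "smooth_map X A Y B \<phi> \<Longrightarrow> c \<in> A \<Longrightarrow> d \<in> B \<Longrightarrow> smooth_on (rep_dom c d \<phi>) (local_rep c d \<phi>)"
  by (simp add: smooth_map_def)

text \<open>Transitions are local representations of the identity, so every fact about smooth maps
  specializes to changes of chart.\<close>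

lemma smooth_map_id:
  assumes "smooth_manifold X A"
  shows "smooth_map X A X A id"
proof -
  have "domain c \<inter> id -` domain d = domain c \<inter> domain d" for c d :: "('a, 'b) chart" by auto
  then show ?thesis
    using assms by (simp add: smooth_map_def smooth_manifold_def continuous_map_id)
qed

lemma local_rep_coord:
  "is_chart X c \<Longrightarrow> x \<in> domain c \<Longrightarrow> local_rep c d \<phi> (coord c x) = coord d (\<phi> x)"
  by (simp add: local_rep_def)

text \<open>Chain rule through an intermediate chart. With both maps the identity it is the cocycle
  rule for transitions; with one of them the identity it changes the chart in which a differential
  is computed.\<close>

lemma D_local_rep_comp:
  assumes X: "smooth_manifold X A" and Y: "smooth_manifold Y B"
    and phi: "smooth_map X A Y B \<phi>" and psi: "smooth_map Y B Z C \<psi>"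
    and c: "c \<in> A" "x \<in> domain c" and d: "d \<in> B" "\<phi> x \<in> domain d" and e: "e \<in> C" "\<psi> (\<phi> x) \<in> domain e"
  shows "D (local_rep c e (\<psi> \<circ> \<phi>)) (coord c x) v
    = D (local_rep d e \<psi>) (coord d (\<phi> x)) (D (local_rep c d \<phi>) (coord c x) v)"
proof -
  have ch: "is_chart X c" "is_chart Y d"
    using smooth_manifold_is_chart X Y c d by blast+
  let ?t = "coord c x"
  have S: "open (rep_dom c d \<phi>)" "?t \<in> rep_dom c d \<phi>"
    using open_rep_dom[OF phi ch] c d by auto
  have "(local_rep d e \<psi> has_derivative D (local_rep d e \<psi>) (coord d (\<phi> x))) (at (local_rep c d \<phi> ?t))"
    using smooth_on_has_derivative[OF smooth_local_rep[OF psi d(1) e(1)], of "coord d (\<phi> x)"] d e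
    by (auto simp: local_rep_coord[OF ch(1) c(2)])
  from has_derivative_compose[OF smooth_on_has_derivative[OF smooth_local_rep[OF phi c(1) d(1)] S(2)] this]
  have "D (\<lambda>t. local_rep d e \<psi> (local_rep c d \<phi> t)) ?t
      = (\<lambda>v. D (local_rep d e \<psi>) (coord d (\<phi> x)) (D (local_rep c d \<phi>) ?t v))"
    by (rule has_derivative_D)
  moreover have "D (local_rep c e (\<psi> \<circ> \<phi>)) ?t = D (\<lambda>t. local_rep d e \<psi> (local_rep c d \<phi> t)) ?t"
    by (rule D_cong_open[OF S]) (auto simp: local_rep_coord[OF ch(1)] local_rep_coord[OF ch(2)])
  ultimately show ?thesis by simp
qed

lemma D_transition_same:
  assumes "smooth_manifold X A" "c \<in> A" "x \<in> domain c"
  shows "D (transition c c) (coord c x) v = v"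
proof -
  have ch: "is_chart X c" using smooth_manifold_is_chart assms by blast
  then have U: "open (coord c ` domain c)" by (simp add: is_chart_def)
  have "D (transition c c) (coord c x) = D (\<lambda>t. t) (coord c x)"
    by (rule D_cong_open[OF U]) (use assms(3) in \<open>auto simp: local_rep_coord[OF ch]\<close>)
  then show ?thesis using has_derivative_D[OF has_derivative_ident] by metis
qed

lemma D_transition_trans:
  assumes X: "smooth_manifold X A" and "c \<in> A" "x \<in> domain c" "d \<in> A" "x \<in> domain d" "e \<in> A" "x \<in> domain e"
  shows "D (transition d e) (coord d x) (D (transition c d) (coord c x) v) = D (transition c e) (coord c x) v"
  using D_local_rep_comp[OF X X smooth_map_id[OF X] smooth_map_id[OF X], of c x d e v] assms by simp

lemma D_transition_inverse:
  assumes "smooth_manifold X A" "c \<in> A" "x \<in> domain c" "d \<in> A" "x \<in> domain d"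
  shows "D (transition d c) (coord d x) (D (transition c d) (coord c x) v) = v"
  using D_transition_trans[of X A c x d c v] D_transition_same[of X A c x v] assms by simp

lemma linear_D_transition:
  assumes "smooth_manifold X A" "c \<in> A" "x \<in> domain c" "d \<in> A" "x \<in> domain d"
  shows "linear (D (transition c d) (coord c x))"
  by (rule smooth_on_linear[OF smooth_local_rep[OF smooth_map_id[OF assms(1)] assms(2,4)]]) (use assms in auto)

section \<open>Tangent vectors, Finsler functions and differentials in charts\<close>

lemma tvec_of_in_tangent_space:
  assumes "smooth_manifold X A" "c \<in> A" "x \<in> domain c"
  shows "tvec_of A x c s \<in> tangent_space A x"
  unfolding tangent_space_def tvec_of_def using D_transition_trans[OF assms] by auto

lemma tvec_of_same:
  assumes "smooth_manifold X A" "c \<in> A" "x \<in> domain c"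
  shows "tvec_of A x c s c = s"
  unfolding tvec_of_def using D_transition_same[OF assms] assms by simp

lemma tvec_of_change:
  assumes "smooth_manifold X A" "c \<in> A" "x \<in> domain c" "d \<in> A" "x \<in> domain d"
  shows "tvec_of A x c s = tvec_of A x d (D (transition c d) (coord c x) s)"
  unfolding tvec_of_def using D_transition_trans[OF assms] by auto

lemma in_coords_coord:
  "is_chart X c \<Longrightarrow> x \<in> domain c \<Longrightarrow> in_coords A F c (coord c x, s) = F x (tvec_of A x c s)"
  by (simp add: in_coords_def)

text \<open>Both sides evaluate \<open>F\<close> at the same tangent vector. This is the source of
  the equality of energies in \<open>spray_change_of_chart\<close>.\<close>

lemma in_coords_change:
  assumes "smooth_manifold X A" "c \<in> A" "x \<in> domain c" "d \<in> A" "x \<in> domain d"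
  shows "in_coords A F c (coord c x, s) = in_coords A F d (coord d x, D (transition c d) (coord c x) s)"
  using assms in_coords_coord[OF smooth_manifold_is_chart] tvec_of_change by metis

text \<open>Homogeneity of \<open>F\<close> concerns families of coordinate vectors over all charts.
  Linearity of the derivatives of transitions shows that scaling the vector in one chart scales the
  whole family.\<close>

lemma local_finsler_in_coords:
  assumes "finsler_manifold X A F" "c \<in> A"
  shows "local_finsler (coord c ` domain c) (in_coords A F c)"
proof
  have X: "smooth_manifold X A" using assms by (simp add: finsler_manifold_def)
  then have ch: "is_chart X c" using smooth_manifold_is_chart assms by blast
  then show "open (coord c ` domain c)" by (simp add: is_chart_def)
  show "smooth_on (coord c ` domain c \<times> (UNIV - {0})) (in_coords A F c)"
    using assms by (simp add: finsler_manifold_def)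
  show "(\<Sum>\<alpha>\<in>UNIV. \<Sum>\<beta>\<in>UNIV. metric (in_coords A F c) \<alpha> \<beta> (t, s) * w $ \<alpha> * w $ \<beta>) > 0"
    if "t \<in> coord c ` domain c" "s \<noteq> 0" "w \<noteq> 0" for t s w
    using assms that unfolding finsler_manifold_def by blast
  have "in_coords A F c (coord c x, r *\<^sub>R s) = r * in_coords A F c (coord c x, s)"
    if x: "x \<in> domain c" and r: "r > 0" for x s and r :: real
  proof -
    have "tvec_of A x c (r *\<^sub>R s) = (\<lambda>d. r *\<^sub>R tvec_of A x c s d)"
      unfolding tvec_of_def using linear_cmul[OF linear_D_transition[OF X assms(2) x]] by auto
    moreover have "x \<in> topspace X" using is_chart_domain_subset[OF ch] x by blast
    ultimately show ?thesis
      using assms(1) tvec_of_in_tangent_space[OF X assms(2) x, of s] r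
      unfolding finsler_manifold_def by (simp add: in_coords_coord[OF ch x])
  qed
  then show "homogeneous_on (coord c ` domain c) 1 (in_coords A F c)"
    by (auto simp: homogeneous_on_def)
qed

text \<open>The differential is computed in an arbitrarily chosen source chart and in all target
  charts. One chain rule replaces the chosen chart by \<open>c\<close>, another passes from
  \<open>d\<close> to the other targets, so a kernel vector in coordinates spans a tangent vector
  killed by the differential.\<close>

lemma nondegenerate_local_rep:
  assumes X: "smooth_manifold X A" and Y: "smooth_manifold Y B"
    and phi: "smooth_map X A Y B \<phi>" and nd: "nondegenerate X A B \<phi>"
    and c: "c \<in> A" "x \<in> domain c" and d: "d \<in> B" "\<phi> x \<in> domain d"
    and s: "D (local_rep c d \<phi>) (coord c x) s = 0"
  shows "s = 0"
proof -
  define c0 where "c0 = (SOME c. c \<in> A \<and> x \<in> domain c)"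
  have c0: "c0 \<in> A" "x \<in> domain c0"
    using someI[of "\<lambda>c. c \<in> A \<and> x \<in> domain c" c] c by (auto simp: c0_def)
  let ?v = "tvec_of A x c s"
  have "differential A B \<phi> x ?v e = 0" for e
  proof (cases "e \<in> B \<and> \<phi> x \<in> domain e")
    case True
    have "D (local_rep c0 e \<phi>) (coord c0 x) (?v c0) = D (local_rep c e \<phi>) (coord c x) s"
      using D_local_rep_comp[OF X X smooth_map_id[OF X] phi c, of c0 e s] c0 True
      by (simp add: tvec_of_def)
    also have "\<dots> = D (transition d e) (coord d (\<phi> x)) (D (local_rep c d \<phi>) (coord c x) s)"
      using D_local_rep_comp[OF X Y phi smooth_map_id[OF Y] c d, of e s] True by simp
    also have "\<dots> = 0" using s linear_0[OF linear_D_transition[OF Y d]] True by simp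
    finally show ?thesis using True by (simp add: differential_def c0_def[symmetric] Let_def)
  qed (auto simp: differential_def Let_def)
  then have "differential A B \<phi> x ?v = (\<lambda>d. 0)" by auto
  moreover have "x \<in> topspace X"
    using is_chart_domain_subset[OF smooth_manifold_is_chart[OF X c(1)]] c by blast
  ultimately have "?v = (\<lambda>c. 0)"
    using nd tvec_of_in_tangent_space[OF X c, of s] unfolding nondegenerate_def by blast
  then show ?thesis using tvec_of_same[OF X c, of s] by simp
qed

section \<open>Autoparallel curves\<close>

definition spray_vec :: "'p::finite phase_fun \<Rightarrow> (real ^ 'p) \<times> (real ^ 'p) \<Rightarrow> real ^ 'p" where
  "spray_vec L z = (\<chi> \<mu>. spray L \<mu> z)"

context local_finsler
begin

lemma smooth_spray_vec: "smooth_on W (spray_vec L)"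
  by (rule smooth_on_vec[OF open_W]) (simp add: spray_vec_def smooth_spray)

lemma D_spray_vec: "z \<in> W \<Longrightarrow> D (spray_vec L) z v $ \<mu> = D (spray L \<mu>) z v"
  using D_bounded_linear_comp[OF smooth_on_differentiable[OF smooth_spray_vec] bounded_linear_vec_nth[of \<mu>], of z v]
  by (simp add: spray_vec_def)

lemma D2_spray_vec:
  assumes "z \<in> W"
  shows "D2 (spray_vec L) z v w $ \<mu> = D2 (spray L \<mu>) z v w"
proof -
  have "D2 (spray_vec L) z v w $ \<mu> = D (\<lambda>z. D (spray_vec L) z v $ \<mu>) z w"
    using D_bounded_linear_comp[OF smooth_on_differentiable[OF smooth_on_D[OF smooth_spray_vec]]
        bounded_linear_vec_nth[of \<mu>], of z v w] assms by simp
  also have "\<dots> = D2 (spray L \<mu>) z v w"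
    by (subst D_cong_open[OF open_W assms]) (auto simp: D_spray_vec)
  finally show ?thesis .
qed

lemma D2_spray_vec_contract:
  assumes "t \<in> U" "s \<noteq> 0"
  shows "D2 (spray_vec L) (t, s) (0, s) (0, s) = 2 *\<^sub>R spray_vec L (t, s)"
  using assms D2_spray_contract[OF assms] by (simp add: vec_eq_iff D2_spray_vec spray_vec_def)

lemma autoparallel_equation_iff:
  assumes "t \<in> U" "s \<noteq> 0"
  shows "(\<forall>\<alpha>. a $ \<alpha> + (\<Sum>\<beta>\<in>UNIV. nonlinear_connection L \<alpha> \<beta> (t, s) * s $ \<beta>) = 0)
    \<longleftrightarrow> a = - 2 *\<^sub>R spray_vec L (t, s)"
  unfolding nonlinear_connection_contract[OF assms]
  by (simp add: vec_eq_iff spray_vec_def add_eq_0_iff2)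

lemma euler_lagrange_spray_vec:
  assumes "t \<in> U" "s \<noteq> 0"
  shows "a = - 2 *\<^sub>R spray_vec L (t, s) \<longleftrightarrow> (\<forall>w. D2 Q (t, s) (0, w) (s, a) = D Q (t, s) (w, 0))"
  unfolding euler_lagrange_iff[OF assms] by (simp add: vec_eq_iff spray_vec_def)

end

section \<open>The spray equation under change of chart, and existence of autoparallel
  curves\<close>

lemma relatively_open_preimage:
  assumes "continuous_map (top_of_set {a..b::real}) X k" "openin X V"
  obtains T where "open T" "\<And>\<sigma>. \<sigma> \<in> {a..b} \<Longrightarrow> \<sigma> \<in> T \<longleftrightarrow> k \<sigma> \<in> V"
proof -
  have "openin (top_of_set {a..b}) {\<sigma> \<in> {a..b}. k \<sigma> \<in> V}"
    using openin_continuous_map_preimage[OF assms] by simp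
  then obtain T where "open T" "{\<sigma> \<in> {a..b}. k \<sigma> \<in> V} = {a..b} \<inter> T"
    by (auto simp: openin_open)
  then show ?thesis using that[of T] by blast
qed

text \<open>Along the curve, the fibre derivative of the energy of \<open>c\<close> paired with a
  fixed \<open>w\<close> equals that of the energy of \<open>d\<close> paired with the image of
  \<open>w\<close>. Differentiating both expressions gives the Euler--Lagrange equation in
  \<open>d\<close>, because the terms with second derivatives of the transition cancel.\<close>

lemma spray_change_of_chart:
  fixes X :: "'a topology" and A :: "('a, 'p::finite) chart set"
  assumes fin: "finsler_manifold X A F" and c: "c \<in> A" and d: "d \<in> A"
    and ab: "a < b" and T: "open T" and reg: "regular_at a b T x"
    and x: "\<And>\<sigma>. \<sigma> \<in> T \<inter> {a..b} \<Longrightarrow> x \<sigma> \<in> rep_dom c d id \<and> velocity a b x \<sigma> \<noteq> 0 \<and> y \<sigma> = transition c d (x \<sigma>)"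
    and \<tau>: "\<tau> \<in> T \<inter> {a..b}"
    and eq: "velocity a b (velocity a b x) \<tau> = - 2 *\<^sub>R spray_vec (in_coords A F c) (x \<tau>, velocity a b x \<tau>)"
  shows "velocity a b y \<tau> \<noteq> 0"
    and "velocity a b (velocity a b y) \<tau> = - 2 *\<^sub>R spray_vec (in_coords A F d) (y \<tau>, velocity a b y \<tau>)"
proof -
  have X: "smooth_manifold X A" using fin by (simp add: finsler_manifold_def)
  have ch: "is_chart X c" "is_chart X d" using smooth_manifold_is_chart[OF X] c d by auto
  let ?S = "rep_dom c d id" and ?\<psi> = "transition c d"
  let ?Uc = "coord c ` domain c" and ?Ud = "coord d ` domain d"
  interpret Lc: local_finsler ?Uc "in_coords A F c" by (rule local_finsler_in_coords[OF fin c])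
  interpret Ld: local_finsler ?Ud "in_coords A F d" by (rule local_finsler_in_coords[OF fin d])
  have sm: "smooth_on ?S ?\<psi>" by (rule smooth_local_rep[OF smooth_map_id[OF X] c d])
  have S: "open ?S" by (rule open_rep_dom[OF smooth_map_id[OF X] ch])
  have SU: "t \<in> ?Uc" "?\<psi> t \<in> ?Ud" if "t \<in> ?S" for t
    using that local_rep_coord[OF ch(1), of _ d id] by auto
  have inv: "D (transition d c) (?\<psi> t) (D ?\<psi> t v) = v"
    "D ?\<psi> t (D (transition d c) (?\<psi> t) v) = v" if t: "t \<in> ?S" for t v
  proof -
    obtain p where p: "t = coord c p" "p \<in> domain c" "p \<in> domain d" using t by auto
    then have "?\<psi> t = coord d p" using local_rep_coord[OF ch(1), of p d id] by simp
    then show "D (transition d c) (?\<psi> t) (D ?\<psi> t v) = v" "D ?\<psi> t (D (transition d c) (?\<psi> t) v) = v"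
      using D_transition_inverse[OF X c p(2) d p(3)] D_transition_inverse[OF X d p(3) c p(2)] p by auto
  qed
  have nz: "D ?\<psi> t s \<noteq> 0" if t: "t \<in> ?S" and s: "s \<noteq> 0" for t s
  proof
    assume "D ?\<psi> t s = 0"
    moreover have "D ?\<psi> t 0 = 0" by (rule linear_0[OF smooth_on_linear[OF sm t]])
    ultimately show False using inv(1)[OF t, of s] inv(1)[OF t, of 0] s by metis
  qed
  note W = Lc.open_W Ld.open_W
  have Qeq: "Lc.Q (t, s) = Ld.Q (?\<psi> t, D ?\<psi> t s)" if t: "t \<in> ?S" for t s
  proof -
    obtain p where p: "t = coord c p" "p \<in> domain c" "p \<in> domain d" using t by auto
    then have "?\<psi> t = coord d p" using local_rep_coord[OF ch(1), of p d id] by simp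
    then show ?thesis using in_coords_change[OF X c p(2) d p(3), of F s] p by simp
  qed
  \<comment> \<open>Derivative of the equality of energies, composed with the tangent map of the
    transition. It is used for vertical directions (momenta) and for base directions
    (forces).\<close>
  have DQ: "D Lc.Q (t, s) (w, r) = D Ld.Q (?\<psi> t, D ?\<psi> t s) (D ?\<psi> t w, D2 ?\<psi> t s w + D ?\<psi> t r)"
    if t: "t \<in> ?S" and s: "s \<noteq> 0" for t s w r
  proof -
    let ?\<Psi> = "\<lambda>z. (?\<psi> (fst z), D ?\<psi> (fst z) (snd z))"
    have 1: "((\<lambda>z. ?\<psi> (fst z)) has_derivative (\<lambda>z. D ?\<psi> t (fst z))) (at (t, s))"
      by (rule has_derivative_compose[where g="?\<psi>", OF has_derivative_fst[OF has_derivative_ident]])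
        (unfold fst_conv, rule smooth_on_has_derivative[OF sm t])
    have 2: "(?\<Psi> has_derivative (\<lambda>z. (D ?\<psi> t (fst z), D2 ?\<psi> t s (fst z) + D ?\<psi> t (snd z)))) (at (t, s))"
      by (rule has_derivative_Pair[OF 1 has_derivative_D_apply[OF S t sm]])
    have 3: "(Ld.Q has_derivative D Ld.Q (?\<psi> t, D ?\<psi> t s)) (at (?\<Psi> (t, s)))"
      using smooth_on_has_derivative[OF Ld.smooth_Q, of "?\<Psi> (t, s)"] SU[OF t] nz[OF t s] by simp
    have "D (\<lambda>z. Ld.Q (?\<Psi> z)) (t, s) = (\<lambda>z. D Ld.Q (?\<psi> t, D ?\<psi> t s) (D ?\<psi> t (fst z), D2 ?\<psi> t s (fst z) + D ?\<psi> t (snd z)))"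
      by (rule has_derivative_D[OF has_derivative_compose[OF 2 3]])
    moreover have "D Lc.Q (t, s) = D (\<lambda>z. Ld.Q (?\<Psi> z)) (t, s)"
      by (rule D_cong_open[OF open_slit[OF S]]) (use t s Qeq in auto)
    ultimately show ?thesis by simp
  qed
  let ?x' = "velocity a b x" and ?y' = "velocity a b y"
  let ?x'' = "velocity a b ?x' \<tau>" and ?y'' = "velocity a b ?y' \<tau>"
  have xS: "\<sigma> \<in> T \<inter> {a..b} \<Longrightarrow> x \<sigma> \<in> ?S \<and> y \<sigma> = ?\<psi> (x \<sigma>)" for \<sigma> using x by blast
  note vi = velocity_image[OF ab T reg S sm xS]
  have y': "?y' \<sigma> = D ?\<psi> (x \<sigma>) (?x' \<sigma>)" if "\<sigma> \<in> T \<inter> {a..b}" for \<sigma>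
    by (rule vi(2)[OF _ that])
  have regy: "regular_at a b T y" by (rule vi(1))
  have zx: "(x \<sigma>, ?x' \<sigma>) \<in> Lc.W" and zy: "(y \<sigma>, ?y' \<sigma>) \<in> Ld.W" if "\<sigma> \<in> T \<inter> {a..b}" for \<sigma>
    using x[OF that] SU[of "x \<sigma>"] nz[of "x \<sigma>" "?x' \<sigma>"] y'[OF that] by auto
  show yn: "?y' \<tau> \<noteq> 0" using zy[OF \<tau>] by auto
  have dx: "(x has_vector_derivative ?x' \<tau>) (at \<tau> within {a..b})"
      "(?x' has_vector_derivative ?x'') (at \<tau> within {a..b})"
      "(y has_vector_derivative ?y' \<tau>) (at \<tau> within {a..b})"
      "(?y' has_vector_derivative ?y'') (at \<tau> within {a..b})"
    using reg regy \<tau> by (auto simp: regular_at_def intro!: has_vector_derivative_velocity)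
  have dz: "((\<lambda>\<sigma>. (x \<sigma>, ?x' \<sigma>)) has_vector_derivative (?x' \<tau>, ?x'')) (at \<tau> within {a..b})"
      "((\<lambda>\<sigma>. (y \<sigma>, ?y' \<sigma>)) has_vector_derivative (?y' \<tau>, ?y'')) (at \<tau> within {a..b})"
    by (intro has_vector_derivative_Pair dx)+
  have EL: "D2 Ld.Q (y \<tau>, ?y' \<tau>) (0, D ?\<psi> (x \<tau>) w) (?y' \<tau>, ?y'') = D Ld.Q (y \<tau>, ?y' \<tau>) (D ?\<psi> (x \<tau>) w, 0)" for w
  proof -
    have xt: "x \<tau> \<in> ?S" "?x' \<tau> \<noteq> 0" "y \<tau> = ?\<psi> (x \<tau>)" using x[OF \<tau>] by auto
    let ?u = "\<lambda>\<sigma>. (0 :: real ^ 'p, D ?\<psi> (x \<sigma>) w)"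
    have "((\<lambda>\<sigma>. D ?\<psi> (x \<sigma>) w) has_vector_derivative D2 ?\<psi> (x \<tau>) w (?x' \<tau>)) (at \<tau> within {a..b})"
      by (rule has_vector_derivative_D_comp[where f="\<lambda>t. D ?\<psi> t w",
            OF smooth_on_differentiable[OF smooth_on_D[OF sm] xt(1)] dx(1)])
    then have du: "(?u has_vector_derivative (0, D2 ?\<psi> (x \<tau>) w (?x' \<tau>))) (at \<tau> within {a..b})"
      by (intro has_vector_derivative_Pair has_vector_derivative_const)
    have l: "((\<lambda>\<sigma>. D Lc.Q (x \<sigma>, ?x' \<sigma>) (0, w)) has_vector_derivative
        D2 Lc.Q (x \<tau>, ?x' \<tau>) (0, w) (?x' \<tau>, ?x'')) (at \<tau> within {a..b})"
      by (rule has_vector_derivative_D_comp[where f="\<lambda>z. D Lc.Q z (0, w)",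
            OF smooth_on_differentiable[OF smooth_on_D[OF Lc.smooth_Q] zx[OF \<tau>]] dz(1)])
    have "((\<lambda>\<sigma>. D Ld.Q (y \<sigma>, ?y' \<sigma>) (?u \<sigma>)) has_vector_derivative
        D2 Ld.Q (y \<tau>, ?y' \<tau>) (?u \<tau>) (?y' \<tau>, ?y'') + D Ld.Q (y \<tau>, ?y' \<tau>) (0, D2 ?\<psi> (x \<tau>) w (?x' \<tau>)))
        (at \<tau> within {a..b})"
      by (rule has_vector_derivative_D_apply[OF W(2) zy[OF \<tau>] Ld.smooth_Q dz(2) du])
    \<comment> \<open>The same momentum as in \<open>l\<close>, now written in the chart
      \<open>d\<close>; its derivative is computed a second time. The pairing vector moves, which
      creates a term with a second derivative of the transition.\<close>
    then have r: "((\<lambda>\<sigma>. D Lc.Q (x \<sigma>, ?x' \<sigma>) (0, w)) has_vector_derivative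
        D2 Ld.Q (y \<tau>, ?y' \<tau>) (?u \<tau>) (?y' \<tau>, ?y'') + D Ld.Q (y \<tau>, ?y' \<tau>) (0, D2 ?\<psi> (x \<tau>) w (?x' \<tau>)))
        (at \<tau> within {a..b})"
    proof (rule has_vector_derivative_cong_open[OF _ T])
      fix \<sigma> assume \<sigma>: "\<sigma> \<in> T" "\<sigma> \<in> {a..b}"
      then have xs: "x \<sigma> \<in> ?S" "?x' \<sigma> \<noteq> 0" "y \<sigma> = ?\<psi> (x \<sigma>)" "?y' \<sigma> = D ?\<psi> (x \<sigma>) (?x' \<sigma>)"
        using x[of \<sigma>] y'[of \<sigma>] by auto
      have "D ?\<psi> (x \<sigma>) 0 = 0" "D2 ?\<psi> (x \<sigma>) (?x' \<sigma>) 0 = 0"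
        by (rule linear_0[OF smooth_on_linear[OF sm xs(1)]], rule linear_0[OF linear_D2_right[OF xs(1) sm]])
      then show "D Lc.Q (x \<sigma>, ?x' \<sigma>) (0, w) = D Ld.Q (y \<sigma>, ?y' \<sigma>) (?u \<sigma>)"
        unfolding xs(3,4) DQ[OF xs(1,2)] by simp
    qed (use \<tau> in auto)
    have "D2 Ld.Q (y \<tau>, ?y' \<tau>) (?u \<tau>) (?y' \<tau>, ?y'') + D Ld.Q (y \<tau>, ?y' \<tau>) (0, D2 ?\<psi> (x \<tau>) w (?x' \<tau>))
      = D2 Lc.Q (x \<tau>, ?x' \<tau>) (0, w) (?x' \<tau>, ?x'')"
      using vector_derivative_within_closed_interval[OF ab _ l]
        vector_derivative_within_closed_interval[OF ab _ r] \<tau> by simp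
    also have "\<dots> = D Lc.Q (x \<tau>, ?x' \<tau>) (w, 0)"
      using Lc.euler_lagrange_spray_vec[of "x \<tau>" "?x' \<tau>" ?x''] eq zx[OF \<tau>] by blast
    also have "\<dots> = D Ld.Q (y \<tau>, ?y' \<tau>) (D ?\<psi> (x \<tau>) w, D2 ?\<psi> (x \<tau>) (?x' \<tau>) w)"
      using DQ[OF xt(1,2), of w 0] linear_0[OF smooth_on_linear[OF sm xt(1)]] by (simp add: xt(3) y'[OF \<tau>])
    \<comment> \<open>The force in the chart \<open>c\<close> carries the same extra term with the
      two directions exchanged, so symmetry makes it cancel.\<close>
    also have "\<dots> = D Ld.Q (y \<tau>, ?y' \<tau>) (D ?\<psi> (x \<tau>) w, 0) + D Ld.Q (y \<tau>, ?y' \<tau>) (0, D2 ?\<psi> (x \<tau>) w (?x' \<tau>))"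
      unfolding symmetric_D2[OF S xt(1) sm, of "?x' \<tau>" w]
      by (rule linear_Pair_split[OF smooth_on_linear[OF Ld.smooth_Q zy[OF \<tau>]]])
    finally show ?thesis by simp
  qed
  \<comment> \<open>So far only test vectors in the image of \<open>D (transition c d)\<close>
    occur; invertibility makes these all vectors.\<close>
  have "D2 Ld.Q (y \<tau>, ?y' \<tau>) (0, w) (?y' \<tau>, ?y'') = D Ld.Q (y \<tau>, ?y' \<tau>) (w, 0)" for w
    using EL[of "D (transition d c) (?\<psi> (x \<tau>)) w"] inv(2)[of "x \<tau>" w] x[OF \<tau>] by simp
  then show "?y'' = - 2 *\<^sub>R spray_vec (in_coords A F d) (y \<tau>, ?y' \<tau>)"
    using Ld.euler_lagrange_spray_vec[of "y \<tau>" "?y' \<tau>" ?y''] zy[OF \<tau>] by blast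
qed

lemma autoparallel_iff:
  assumes fin: "finsler_manifold X A F"
  shows "autoparallel X A F a b k \<longleftrightarrow> a < b \<and> continuous_map (top_of_set {a..b}) X k \<and>
    (\<forall>c\<in>A. \<forall>\<tau>\<in>{a..b}. k \<tau> \<in> domain c \<longrightarrow>
      regular_at a b {\<tau>} (coord c \<circ> k) \<and> velocity a b (coord c \<circ> k) \<tau> \<noteq> 0 \<and>
      velocity a b (velocity a b (coord c \<circ> k)) \<tau> =
        - 2 *\<^sub>R spray_vec (in_coords A F c) (coord c (k \<tau>), velocity a b (coord c \<circ> k) \<tau>))"
proof -
  have step: "(coord c \<circ> k differentiable (at \<tau> within {a..b}) \<and>
      velocity a b (coord c \<circ> k) differentiable (at \<tau> within {a..b}) \<and>
      velocity a b (coord c \<circ> k) \<tau> \<noteq> 0 \<and>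
      (\<forall>\<alpha>. velocity a b (velocity a b (coord c \<circ> k)) \<tau> $ \<alpha> +
        (\<Sum>\<beta>\<in>UNIV. nonlinear_connection (in_coords A F c) \<alpha> \<beta> ((coord c \<circ> k) \<tau>, velocity a b (coord c \<circ> k) \<tau>)
          * velocity a b (coord c \<circ> k) \<tau> $ \<beta>) = 0)) \<longleftrightarrow>
      regular_at a b {\<tau>} (coord c \<circ> k) \<and> velocity a b (coord c \<circ> k) \<tau> \<noteq> 0 \<and>
      velocity a b (velocity a b (coord c \<circ> k)) \<tau> =
        - 2 *\<^sub>R spray_vec (in_coords A F c) (coord c (k \<tau>), velocity a b (coord c \<circ> k) \<tau>)"
    if "c \<in> A" "\<tau> \<in> {a..b}" "k \<tau> \<in> domain c" for c \<tau>
  proof -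
    interpret local_finsler "coord c ` domain c" "in_coords A F c"
      by (rule local_finsler_in_coords[OF fin that(1)])
    have "regular_at a b {\<tau>} (coord c \<circ> k) \<longleftrightarrow> coord c \<circ> k differentiable (at \<tau> within {a..b}) \<and>
        velocity a b (coord c \<circ> k) differentiable (at \<tau> within {a..b})"
      using that(2) by (simp add: regular_at_def)
    moreover have "coord c (k \<tau>) \<in> coord c ` domain c" using that(3) by simp
    ultimately show ?thesis
      using autoparallel_equation_iff[of "coord c (k \<tau>)" "velocity a b (coord c \<circ> k) \<tau>"]
      unfolding comp_apply[of "coord c" k \<tau>] by blast
  qed
  show ?thesis
    unfolding autoparallel_def Let_def
    by (rule conj_cong[OF refl], rule conj_cong[OF refl], rule ball_cong[OF refl], rule ball_cong[OF refl],
        rule imp_cong[OF refl], rule step)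
qed

lemma regular_at_point: "regular_at a b T x \<Longrightarrow> \<tau> \<in> T \<inter> {a..b} \<Longrightarrow> regular_at a b {\<tau>} x"
  by (simp add: regular_at_def)

lemma regular_at_union:
  "(\<And>\<tau>. \<tau> \<in> T \<inter> {a..b} \<Longrightarrow> regular_at a b {\<tau>} x) \<Longrightarrow> regular_at a b T x"
  by (auto simp: regular_at_def)

text \<open>The initial point sits at the left end of the interval, where derivatives are one-sided,
  so a forward solution of the initial value problem is enough. It stays in the chart
  \<open>c\<close>, yet the equation must also be checked in every other chart that the curve
  meets.\<close>

lemma exists_autoparallel:
  fixes X :: "'a topology" and A :: "('a, 'p::finite) chart set"
  assumes fin: "finsler_manifold X A F" and c: "c \<in> A"
    and t: "t \<in> coord c ` domain c" and s: "s \<noteq> 0"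
  obtains b k where "0 < b" "autoparallel X A F 0 b k" "k 0 = point_of c t"
    "velocity 0 b (coord c \<circ> k) 0 = s"
proof -
  have X: "smooth_manifold X A" using fin by (simp add: finsler_manifold_def)
  have ch: "is_chart X c" using smooth_manifold_is_chart[OF X] c by auto
  let ?U = "coord c ` domain c"
  interpret local_finsler ?U "in_coords A F c" by (rule local_finsler_in_coords[OF fin c])
  let ?G = "spray_vec (in_coords A F c)"
  \<comment> \<open>Reduction to a first-order system on the slit bundle. A solution that remains in
    \<open>W\<close> stays in the chart and has nonzero velocity automatically.\<close>
  have "smooth_on W (\<lambda>z. (snd z, (-2) *\<^sub>R ?G z))"
    by (intro smooth_on_Pair smooth_on_scaleR smooth_on_const smooth_spray_vec open_W
        smooth_on_bounded_linear bounded_linear_snd)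
  from picard_local[OF open_W _ this, of "(t, s)"]
  obtain b z where b: "0 < b" and z0: "z 0 = (t, s)"
    and zW: "\<And>\<tau>. \<tau> \<in> {0..b} \<Longrightarrow> z \<tau> \<in> W"
    and z': "\<And>\<tau>. \<tau> \<in> {0..b} \<Longrightarrow> (z has_vector_derivative (snd (z \<tau>), (-2) *\<^sub>R ?G (z \<tau>))) (at \<tau> within {0..b})"
    using t s by blast
  define x where "x \<tau> = fst (z \<tau>)" for \<tau>
  define k where "k \<tau> = point_of c (x \<tau>)" for \<tau>
  have x': "(x has_vector_derivative snd (z \<tau>)) (at \<tau> within {0..b})" if "\<tau> \<in> {0..b}" for \<tau>
    using bounded_linear.has_vector_derivative[OF bounded_linear_fst z'[OF that]] by (simp add: x_def[abs_def])
  have v: "velocity 0 b x \<tau> = snd (z \<tau>)" if "\<tau> \<in> {0..b}" for \<tau>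
    by (rule velocityI[OF b that x'[OF that]])
  have "((\<lambda>\<tau>. snd (z \<tau>)) has_vector_derivative (-2) *\<^sub>R ?G (z \<tau>)) (at \<tau> within {0..b})" if "\<tau> \<in> {0..b}" for \<tau>
    using bounded_linear.has_vector_derivative[OF bounded_linear_snd z'[OF that]] by simp
  note sz = this
  have x'': "(velocity 0 b x has_vector_derivative (-2) *\<^sub>R ?G (z \<tau>)) (at \<tau> within {0..b})"
    if "\<tau> \<in> {0..b}" for \<tau>
    by (rule has_vector_derivative_transform[OF that v sz[OF that]])
  have reg: "regular_at 0 b T x" for T
    using x' x'' unfolding regular_at_def by (blast intro: differentiableI_vector)
  have xU: "x \<tau> \<in> ?U" and vn: "velocity 0 b x \<tau> \<noteq> 0" if "\<tau> \<in> {0..b}" for \<tau>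
    using zW[OF that] v[OF that] by (auto simp: x_def mem_Times_iff)
  have eq: "velocity 0 b (velocity 0 b x) \<tau> = - 2 *\<^sub>R ?G (x \<tau>, velocity 0 b x \<tau>)" if "\<tau> \<in> {0..b}" for \<tau>
    using velocityI[OF b that x''[OF that]] v[OF that] by (simp add: x_def)
  have "continuous_on {0..b} x"
    using x' has_vector_derivative_continuous continuous_on_eq_continuous_within by blast
  then have "continuous_map (top_of_set {0..b}) (top_of_set ?U) x"
    using xU by (auto simp: continuous_map_in_subtopology)
  from continuous_map_compose[OF this continuous_map_point_of[OF ch]]
  have kc: "continuous_map (top_of_set {0..b}) X k" by (simp add: k_def[abs_def] o_def)
  have kd: "k \<tau> \<in> domain c" "coord c (k \<tau>) = x \<tau>" if "\<tau> \<in> {0..b}" for \<tau>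
    using point_of_in_domain[OF xU[OF that]] coord_point_of[OF xU[OF that]] by (auto simp: k_def)
  \<comment> \<open>The velocity formula is included for the case where \<open>e\<close> is
    \<open>c\<close> itself: the derivative of the trivial transition is the identity, which
    recovers the prescribed initial velocity.\<close>
  have main: "regular_at 0 b {\<tau>} (coord e \<circ> k) \<and> velocity 0 b (coord e \<circ> k) \<tau> \<noteq> 0 \<and>
      velocity 0 b (velocity 0 b (coord e \<circ> k)) \<tau> =
        - 2 *\<^sub>R spray_vec (in_coords A F e) (coord e (k \<tau>), velocity 0 b (coord e \<circ> k) \<tau>) \<and>
      velocity 0 b (coord e \<circ> k) \<tau> = D (transition c e) (x \<tau>) (velocity 0 b x \<tau>)"
    if e: "e \<in> A" and \<tau>: "\<tau> \<in> {0..b}" "k \<tau> \<in> domain e" for e \<tau>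
  proof -
    have che: "is_chart X e" using smooth_manifold_is_chart[OF X] e by auto
    then have "openin X (domain e)" by (simp add: is_chart_def)
    from relatively_open_preimage[OF kc this] obtain T where T: "open T"
      "\<And>\<sigma>. \<sigma> \<in> {0..b} \<Longrightarrow> \<sigma> \<in> T \<longleftrightarrow> k \<sigma> \<in> domain e" by blast
    have xe: "x \<sigma> \<in> rep_dom c e id \<and> (coord e \<circ> k) \<sigma> = transition c e (x \<sigma>)" if "\<sigma> \<in> T \<inter> {0..b}" for \<sigma>
      using that T(2)[of \<sigma>] kd[of \<sigma>] local_rep_coord[OF ch kd(1), of \<sigma> e id]
      by (auto intro: rev_image_eqI)
    then have xe': "x \<sigma> \<in> rep_dom c e id \<and> velocity 0 b x \<sigma> \<noteq> 0 \<and> (coord e \<circ> k) \<sigma> = transition c e (x \<sigma>)"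
      if "\<sigma> \<in> T \<inter> {0..b}" for \<sigma>
      using that vn by blast
    have \<tau>T: "\<tau> \<in> T \<inter> {0..b}" using T \<tau> by auto
    note sc = spray_change_of_chart[OF fin c e b T(1) reg xe' \<tau>T eq[OF \<tau>(1)]]
    note vi = velocity_image[OF b T(1) reg open_rep_dom[OF smooth_map_id[OF X] ch che]
        smooth_local_rep[OF smooth_map_id[OF X] c e] xe]
    have "regular_at 0 b {\<tau>} (coord e \<circ> k)"
      by (rule regular_at_point[OF vi(1) \<tau>T])
    moreover have "velocity 0 b (coord e \<circ> k) \<tau> = D (transition c e) (x \<tau>) (velocity 0 b x \<tau>)"
      by (rule vi(2)[OF _ \<tau>T])
    moreover have "velocity 0 b (velocity 0 b (coord e \<circ> k)) \<tau> =
        - 2 *\<^sub>R spray_vec (in_coords A F e) ((coord e \<circ> k) \<tau>, velocity 0 b (coord e \<circ> k) \<tau>)"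
      by (rule sc(2))
    moreover have "velocity 0 b (coord e \<circ> k) \<tau> \<noteq> 0" by (rule sc(1))
    ultimately show ?thesis by simp
  qed
  then have "autoparallel X A F 0 b k"
    unfolding autoparallel_iff[OF fin] using b kc by blast
  moreover have z: "0 \<in> {0..b}" using b by simp
  have "velocity 0 b (coord c \<circ> k) 0 = s"
    using main[OF c z kd(1)[OF z]] D_transition_same[OF X c kd(1)[OF z], of s] kd(2)[OF z] v[OF z] z0 by simp
  moreover have "k 0 = point_of c t" by (simp add: k_def x_def z0)
  ultimately show ?thesis using b that by blast
qed

section \<open>Affine maps\<close>

text \<open>In index-free form the Berwald coefficients are second fibre derivatives of
  \<open>spray_vec\<close>. The base vector \<open>s\<close> is kept apart from \<open>v\<close> and
  \<open>w\<close>, since they agree only on the diagonal.\<close>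

definition affine_defect ::
  "(real ^ 'p::finite \<Rightarrow> real ^ 'n::finite) \<Rightarrow> 'p phase_fun \<Rightarrow> 'n phase_fun \<Rightarrow>
    real ^ 'p \<Rightarrow> real ^ 'p \<Rightarrow> real ^ 'p \<Rightarrow> real ^ 'p \<Rightarrow> real ^ 'n" where
  "affine_defect f L L' t s v w =
     D2 f t v w - D f t (D2 (spray_vec L) (t, s) (0, v) (0, w))
     + D2 (spray_vec L') (f t, D f t s) (0, D f t v) (0, D f t w)"

text \<open>A smooth map in a pair of charts. The assumption \<open>inj_D\<close> is nondegeneracy;
  it places \<open>(f t, D f t s)\<close> in the slit bundle, where the spray of \<open>L'\<close>
  can be differentiated.\<close>

locale finsler_local_map = L: local_finsler U L + L': local_finsler U' L'
  for U :: "(real ^ 'p::finite) set" and L and U' :: "(real ^ 'n::finite) set" and L' +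
  fixes f :: "real ^ 'p \<Rightarrow> real ^ 'n" and S :: "(real ^ 'p) set"
  assumes open_S: "open S" and smooth_f: "smooth_on S f"
    and S_U: "S \<subseteq> U" and f_U': "t \<in> S \<Longrightarrow> f t \<in> U'"
    and inj_D: "t \<in> S \<Longrightarrow> s \<noteq> 0 \<Longrightarrow> D f t s \<noteq> 0"
begin

lemma linear_Df: "t \<in> S \<Longrightarrow> linear (D f t)"
  by (rule smooth_on_linear[OF smooth_f])

lemma in_W: "t \<in> S \<Longrightarrow> s \<noteq> 0 \<Longrightarrow> (t, s) \<in> L.W"
  using S_U by auto

lemma in_W': "t \<in> S \<Longrightarrow> s \<noteq> 0 \<Longrightarrow> (f t, D f t s) \<in> L'.W"
  using f_U' inj_D by auto

lemma linear_affine_defect: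
  assumes t: "t \<in> S" and s: "s \<noteq> 0"
  shows "linear (\<lambda>v. affine_defect f L L' t s v w)" "linear (\<lambda>w. affine_defect f L L' t s v w)"
proof -
  note z = in_W[OF t s] in_W'[OF t s]
  note A = linear_compose[OF linear_Df[OF t], unfolded o_def]
  note B = linear_compose[OF _ linear_Df[OF t], unfolded o_def]
  show "linear (\<lambda>v. affine_defect f L L' t s v w)"
    unfolding affine_defect_def
    by (intro linear_compose_add linear_compose_sub B A[where g="\<lambda>v. D2 (spray_vec L') (f t, D f t s) (0, v) u" for u]
        linear_snd_part[where h="\<lambda>v. D2 (spray_vec L) (t, s) v u" for u]
        linear_snd_part[where h="\<lambda>v. D2 (spray_vec L') (f t, D f t s) v u" for u]
        linear_D2_left[OF open_S t smooth_f] linear_D2_left[OF L.open_W z(1) L.smooth_spray_vec]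
        linear_D2_left[OF L'.open_W z(2) L'.smooth_spray_vec])
  show "linear (\<lambda>w. affine_defect f L L' t s v w)"
    unfolding affine_defect_def
    by (intro linear_compose_add linear_compose_sub B A[where g="\<lambda>v. D2 (spray_vec L') (f t, D f t s) u (0, v)" for u]
        linear_snd_part[where h="\<lambda>v. D2 (spray_vec L) (t, s) u v" for u]
        linear_snd_part[where h="\<lambda>v. D2 (spray_vec L') (f t, D f t s) u v" for u]
        linear_D2_right[OF t smooth_f] linear_D2_right[OF z(1) L.smooth_spray_vec]
        linear_D2_right[OF z(2) L'.smooth_spray_vec])
qed

lemma partial1_component:
  assumes "t \<in> S"
  shows "partial1 \<alpha> (\<lambda>t. f t $ i) t = D f t (axis \<alpha> 1) $ i"
  unfolding partial1_def
  by (rule D_bounded_linear_comp[OF smooth_on_differentiable[OF smooth_f assms] bounded_linear_vec_nth])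

lemma partial2_component:
  assumes "t \<in> S"
  shows "partial2 \<alpha> \<beta> (\<lambda>t. f t $ i) t = D2 f t (axis \<beta> 1) (axis \<alpha> 1) $ i"
proof -
  have "partial2 \<alpha> \<beta> (\<lambda>t. f t $ i) t = D (\<lambda>t. D f t (axis \<beta> 1) $ i) t (axis \<alpha> 1)"
    unfolding partial2_def
    by (subst partial1_def, subst D_cong_open[OF open_S assms]) (auto simp: partial1_component)
  then show ?thesis
    using D_bounded_linear_comp[OF smooth_on_differentiable[OF smooth_on_D[OF smooth_f] assms] bounded_linear_vec_nth]
    by simp
qed

text \<open>In \<open>berwald\<close> the last index belongs to the inner derivative, hence
  \<open>axis \<beta> 1\<close> fills the first slot and \<open>axis \<alpha> 1\<close> the
  second.\<close>

lemma affine_defect_component: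
  assumes t: "t \<in> S" and s: "s \<noteq> 0"
  shows "affine_defect f L L' t s (axis \<beta> 1) (axis \<alpha> 1) $ i =
    partial2 \<alpha> \<beta> (\<lambda>t. f t $ i) t
    - (\<Sum>\<gamma>\<in>UNIV. berwald L \<gamma> \<alpha> \<beta> (t, s) * partial1 \<gamma> (\<lambda>t. f t $ i) t)
    + (\<Sum>j\<in>UNIV. \<Sum>k\<in>UNIV. berwald L' i j k (f t, (\<chi> i. \<Sum>\<epsilon>\<in>UNIV. partial1 \<epsilon> (\<lambda>t. f t $ i) t * s $ \<epsilon>))
        * partial1 \<alpha> (\<lambda>t. f t $ j) t * partial1 \<beta> (\<lambda>t. f t $ k) t)"
proof -
  note z = in_W[OF t s] in_W'[OF t s]
  have y: "(\<chi> i. \<Sum>\<epsilon>\<in>UNIV. partial1 \<epsilon> (\<lambda>t. f t $ i) t * s $ \<epsilon>) = D f t s"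
    using linear_axis_sum[OF linear_Df[OF t], of s]
    by (simp add: vec_eq_iff partial1_component[OF t] mult.commute)
  have 1: "(\<Sum>\<gamma>\<in>UNIV. berwald L \<gamma> \<alpha> \<beta> (t, s) * partial1 \<gamma> (\<lambda>t. f t $ i) t)
      = D f t (D2 (spray_vec L) (t, s) (0, axis \<beta> 1) (0, axis \<alpha> 1)) $ i"
    using linear_axis_sum[OF linear_Df[OF t], of "D2 (spray_vec L) (t, s) (0, axis \<beta> 1) (0, axis \<alpha> 1)"]
    by (simp add: partial1_component[OF t] L.berwald_eq L.D2_spray_vec[OF z(1)])
  let ?H = "D2 (spray_vec L') (f t, D f t s)"
  have l: "linear (\<lambda>v. ?H (0, v) u)" "linear (\<lambda>v. ?H u (0, v))" for u
    by (rule linear_snd_part[OF linear_D2_left[OF L'.open_W z(2) L'.smooth_spray_vec]],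
        rule linear_snd_part[OF linear_D2_right[OF z(2) L'.smooth_spray_vec]])
  have H: "?H (0, v) (0, w) $ i = (\<Sum>j\<in>UNIV. \<Sum>k\<in>UNIV. w $ j * (v $ k * (?H (0, axis k 1) (0, axis j 1) $ i)))" for v w
  proof -
    have "?H (0, v) (0, w) = (\<Sum>j\<in>UNIV. w $ j *\<^sub>R (\<Sum>k\<in>UNIV. v $ k *\<^sub>R ?H (0, axis k 1) (0, axis j 1)))"
      by (subst linear_axis_sum[OF l(2)], subst linear_axis_sum[OF l(1)]) (rule refl)
    then show ?thesis by (simp add: sum_distrib_left)
  qed
  have 2: "(\<Sum>j\<in>UNIV. \<Sum>k\<in>UNIV. berwald L' i j k (f t, D f t s)
        * partial1 \<alpha> (\<lambda>t. f t $ j) t * partial1 \<beta> (\<lambda>t. f t $ k) t)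
      = ?H (0, D f t (axis \<beta> 1)) (0, D f t (axis \<alpha> 1)) $ i"
    by (subst H, intro sum.cong refl)
      (simp add: partial1_component[OF t] L'.berwald_eq L'.D2_spray_vec[OF z(2)] mult_ac)
  show ?thesis unfolding y 1 2 partial2_component[OF t] affine_defect_def by simp
qed

lemma affine_equations_iff:
  assumes t: "t \<in> S" and s: "s \<noteq> 0"
  shows "(\<forall>\<alpha> \<beta> i. partial2 \<alpha> \<beta> (\<lambda>t. f t $ i) t
    - (\<Sum>\<gamma>\<in>UNIV. berwald L \<gamma> \<alpha> \<beta> (t, s) * partial1 \<gamma> (\<lambda>t. f t $ i) t)
    + (\<Sum>j\<in>UNIV. \<Sum>k\<in>UNIV. berwald L' i j k (f t, (\<chi> i. \<Sum>\<epsilon>\<in>UNIV. partial1 \<epsilon> (\<lambda>t. f t $ i) t * s $ \<epsilon>))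
        * partial1 \<alpha> (\<lambda>t. f t $ j) t * partial1 \<beta> (\<lambda>t. f t $ k) t) = 0)
    \<longleftrightarrow> (\<forall>v w. affine_defect f L L' t s v w = 0)"
proof -
  have z: "linear (\<lambda>v. 0 :: real ^ 'n)" by (rule linear_zero)
  have "(\<forall>v w. affine_defect f L L' t s v w = 0) \<longleftrightarrow>
      (\<forall>v \<alpha>. affine_defect f L L' t s v (axis \<alpha> 1) = 0)"
    using linear_eq_iff_axis[OF linear_affine_defect(2)[OF t s] z] by auto
  also have "\<dots> \<longleftrightarrow> (\<forall>\<beta> \<alpha>. affine_defect f L L' t s (axis \<beta> 1) (axis \<alpha> 1) = 0)"
    using linear_eq_iff_axis[OF linear_affine_defect(1)[OF t s] z] by auto
  finally show ?thesis
    unfolding affine_defect_component[OF t s, symmetric] by (auto simp: vec_eq_iff)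
qed

lemma affine_defect_diagonal:
  assumes t: "t \<in> S" and s: "s \<noteq> 0"
  shows "affine_defect f L L' t s s s =
    D2 f t s s - 2 *\<^sub>R D f t (spray_vec L (t, s)) + 2 *\<^sub>R spray_vec L' (f t, D f t s)"
  using in_W[OF t s] in_W'[OF t s] L.D2_spray_vec_contract[of t s] L'.D2_spray_vec_contract[of "f t" "D f t s"]
  by (simp add: affine_defect_def linear_cmul[OF linear_Df[OF t]])

text \<open>The second derivative of \<open>\<lambda>s. affine_defect f L L' t s s s\<close> is twice the full defect,
  because Euler's relation removes the second derivatives of the sprays from the diagonal.\<close>

lemma affine_defect_polarize:
  assumes t: "t \<in> S" and zero: "\<And>s. s \<noteq> 0 \<Longrightarrow> affine_defect f L L' t s s s = 0" and s: "s \<noteq> 0"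
  shows "affine_defect f L L' t s v w = 0"
proof -
  let ?A = "D f t" and ?B = "\<lambda>v w. D2 f t v w"
  have O: "open (UNIV - {0 :: real ^ 'p})" by (intro open_Diff) auto
  have blA: "bounded_linear ?A" using linear_Df[OF t] by (simp add: linear_conv_bounded_linear)
  have B: "bounded_bilinear ?B"
    using linear_D2_left[OF open_S t smooth_f] linear_D2_right[OF t smooth_f]
    by (simp add: bilinear_conv_bounded_bilinear[symmetric] bilinear_def)
  \<comment> \<open>The diagonal of the defect as rewritten by
    \<open>affine_defect_diagonal\<close>: in this form \<open>s\<close> can be differentiated
    without meeting third derivatives of the sprays.\<close>
  define P where "P s = ?B s s - 2 *\<^sub>R ?A (spray_vec L (t, s)) + 2 *\<^sub>R spray_vec L' (f t, ?A s)" for s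
  have d1: "((\<lambda>s. h (t, s)) has_derivative (\<lambda>v. D h (t, s) (0, v))) (at s)"
    if "smooth_on L.W h" "s \<noteq> 0" for h :: "_ \<Rightarrow> real ^ 'p" and s
    by (rule has_derivative_snd_part[OF smooth_on_differentiable[OF that(1) in_W[OF t that(2)]]])
  have d2: "((\<lambda>s. h (f t, ?A s)) has_derivative (\<lambda>v. D h (f t, ?A s) (0, ?A v))) (at s)"
    if "smooth_on L'.W h" "s \<noteq> 0" for h :: "_ \<Rightarrow> real ^ 'n" and s
    by (rule has_derivative_compose[where g="\<lambda>y. h (f t, y)" and f="?A",
          OF bounded_linear_imp_has_derivative[OF blA]
          has_derivative_snd_part[OF smooth_on_differentiable[OF that(1) in_W'[OF t that(2)]]]])
  have DP: "(P has_derivative (\<lambda>v. (?B s v + ?B v s) - 2 *\<^sub>R ?A (D (spray_vec L) (t, s) (0, v))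
      + 2 *\<^sub>R D (spray_vec L') (f t, ?A s) (0, ?A v))) (at s)" if "s \<noteq> 0" for s
    unfolding P_def[abs_def]
    by (intro has_derivative_add has_derivative_diff bounded_bilinear.FDERIV[OF B]
        has_derivative_ident has_derivative_scaleR_right bounded_linear.has_derivative[OF blA]
        d1 d2 that L.smooth_spray_vec L'.smooth_spray_vec)
  have P0: "P s = 0" if "s \<noteq> 0" for s
    using zero[OF that] affine_defect_diagonal[OF t that] by (simp add: P_def)
  \<comment> \<open>The derivative of \<open>P\<close> in direction \<open>v\<close>. It vanishes
    because \<open>P\<close> is zero on the open set of nonzero vectors, and the same reasoning is
    repeated for \<open>R\<close> in direction \<open>w\<close>.\<close>
  define R where "R s = (?B s v + ?B v s) - 2 *\<^sub>R ?A (D (spray_vec L) (t, s) (0, v))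
      + 2 *\<^sub>R D (spray_vec L') (f t, ?A s) (0, ?A v)" for s
  have R0: "R s = 0" if "s \<noteq> 0" for s
  proof -
    have "D P s = D (\<lambda>s. 0) s" by (rule D_cong_open[OF O]) (use that P0 in auto)
    then have "D P s v = 0" by simp
    then show ?thesis unfolding has_derivative_D[OF DP[OF that]] R_def .
  qed
  have DR: "(R has_derivative (\<lambda>w. (?B w v + ?B v w) - 2 *\<^sub>R ?A (D2 (spray_vec L) (t, s) (0, v) (0, w))
      + 2 *\<^sub>R D2 (spray_vec L') (f t, ?A s) (0, ?A v) (0, ?A w))) (at s)"
    unfolding R_def[abs_def]
    by (intro has_derivative_add has_derivative_diff
        bounded_linear_imp_has_derivative[OF bounded_bilinear.bounded_linear_left[OF B]]
        bounded_linear_imp_has_derivative[OF bounded_bilinear.bounded_linear_right[OF B]]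
        has_derivative_scaleR_right bounded_linear.has_derivative[OF blA]
        d1[where h="\<lambda>z. D (spray_vec L) z (0, v)"] d2[where h="\<lambda>z. D (spray_vec L') z (0, ?A v)"]
        s smooth_on_D L.smooth_spray_vec L'.smooth_spray_vec)
  have "D R s = D (\<lambda>s. 0) s" by (rule D_cong_open[OF O]) (use s R0 in auto)
  then have "D R s w = 0" by simp
  then have "(?B w v + ?B v w) - 2 *\<^sub>R ?A (D2 (spray_vec L) (t, s) (0, v) (0, w))
      + 2 *\<^sub>R D2 (spray_vec L') (f t, ?A s) (0, ?A v) (0, ?A w) = 0"
    unfolding has_derivative_D[OF DR] .
  \<comment> \<open>Symmetry merges the two bilinear terms into twice one of them, matching the
    factor 2 in front of the sprays.\<close>
  then have "2 *\<^sub>R affine_defect f L L' t s v w = 0"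
    unfolding affine_defect_def symmetric_D2[OF open_S t smooth_f, of w v]
    by (simp add: scaleR_2 algebra_simps)
  then show ?thesis by simp
qed

end

section \<open>From charts to manifolds: the two implications\<close>

locale finsler_map =
  fixes X :: "'a topology" and A :: "('a, 'p::finite) chart set"
    and F :: "'a \<Rightarrow> ('a, 'p) tvec \<Rightarrow> real"
    and Y :: "'b topology" and B :: "('b, 'n::finite) chart set"
    and F' :: "'b \<Rightarrow> ('b, 'n) tvec \<Rightarrow> real"
    and \<phi> :: "'a \<Rightarrow> 'b"
  assumes fin: "finsler_manifold X A F"
    and fin': "finsler_manifold Y B F'"
    and smooth: "smooth_map X A Y B \<phi>"
    and nondeg: "nondegenerate X A B \<phi>"
begin

lemma manifold: "smooth_manifold X A" "smooth_manifold Y B"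
  using fin fin' by (simp_all add: finsler_manifold_def)

lemma charts: "c \<in> A \<Longrightarrow> is_chart X c" "d \<in> B \<Longrightarrow> is_chart Y d"
  using manifold smooth_manifold_is_chart by blast+

lemma local_map:
  assumes c: "c \<in> A" and d: "d \<in> B"
  shows "finsler_local_map (coord c ` domain c) (in_coords A F c) (coord d ` domain d) (in_coords B F' d)
    (local_rep c d \<phi>) (rep_dom c d \<phi>)"
proof -
  interpret L: local_finsler "coord c ` domain c" "in_coords A F c" by (rule local_finsler_in_coords[OF fin c])
  interpret L': local_finsler "coord d ` domain d" "in_coords B F' d" by (rule local_finsler_in_coords[OF fin' d])
  show ?thesis
  proof
    show "open (rep_dom c d \<phi>)" by (rule open_rep_dom[OF smooth charts(1)[OF c] charts(2)[OF d]])
    show "smooth_on (rep_dom c d \<phi>) (local_rep c d \<phi>)" by (rule smooth_local_rep[OF smooth c d])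
    show "rep_dom c d \<phi> \<subseteq> coord c ` domain c" by auto
    show "local_rep c d \<phi> t \<in> coord d ` domain d" if t: "t \<in> rep_dom c d \<phi>" for t
    proof -
      obtain x where "t = coord c x" "x \<in> domain c" "\<phi> x \<in> domain d" using t by auto
      then show ?thesis using local_rep_coord[OF charts(1)[OF c], of x d \<phi>] by simp
    qed
    show "D (local_rep c d \<phi>) t s \<noteq> 0" if t: "t \<in> rep_dom c d \<phi>" and s: "s \<noteq> 0" for t s
    proof -
      obtain x where "t = coord c x" "x \<in> domain c" "\<phi> x \<in> domain d" using t by auto
      then show ?thesis using nondegenerate_local_rep[OF manifold smooth nondeg c _ d] s by blast
    qed
  qed
qed

text \<open>Polarization at each base point reduces the affine map equation to its diagonal, which
  is the part that curves can detect.\<close>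

lemma affine_map_iff:
  "affine_map A F B F' \<phi> \<longleftrightarrow> (\<forall>c\<in>A. \<forall>d\<in>B. \<forall>t\<in>rep_dom c d \<phi>. \<forall>s. s \<noteq> 0 \<longrightarrow>
    affine_defect (local_rep c d \<phi>) (in_coords A F c) (in_coords B F' d) t s s s = 0)"
proof -
  have "(\<forall>s. s \<noteq> 0 \<longrightarrow> (\<forall>v w. affine_defect (local_rep c d \<phi>) (in_coords A F c) (in_coords B F' d) t s v w = 0))
      \<longleftrightarrow> (\<forall>s. s \<noteq> 0 \<longrightarrow> affine_defect (local_rep c d \<phi>) (in_coords A F c) (in_coords B F' d) t s s s = 0)"
    if "c \<in> A" "d \<in> B" "t \<in> rep_dom c d \<phi>" for c d t
    using finsler_local_map.affine_defect_polarize[OF local_map[OF that(1,2)] that(3)] by blast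
  moreover have "affine_map A F B F' \<phi> \<longleftrightarrow> (\<forall>c\<in>A. \<forall>d\<in>B. \<forall>t\<in>rep_dom c d \<phi>. \<forall>s. s \<noteq> 0 \<longrightarrow>
    (\<forall>v w. affine_defect (local_rep c d \<phi>) (in_coords A F c) (in_coords B F' d) t s v w = 0))"
    unfolding affine_map_def Let_def
    using finsler_local_map.affine_equations_iff[OF local_map] by (intro ball_cong refl all_cong) simp
  ultimately show ?thesis by simp
qed

text \<open>Substituting the spray equation of \<open>k\<close> into the acceleration of the image
  curve leaves exactly the diagonal defect. Both implications read off this identity, in opposite
  directions.\<close>

lemma velocity_local_rep:
  assumes k: "autoparallel X A F a b k" and c: "c \<in> A" and d: "d \<in> B"
    and \<tau>: "\<tau> \<in> {a..b}" "k \<tau> \<in> domain c" "\<phi> (k \<tau>) \<in> domain d"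
  defines "f \<equiv> local_rep c d \<phi>" and "x \<equiv> coord c \<circ> k" and "y \<equiv> coord d \<circ> (\<phi> \<circ> k)"
  shows "regular_at a b {\<tau>} y" "velocity a b x \<tau> \<noteq> 0"
    "velocity a b y \<tau> = D f (x \<tau>) (velocity a b x \<tau>)"
    "velocity a b (velocity a b y) \<tau> + 2 *\<^sub>R spray_vec (in_coords B F' d) (y \<tau>, velocity a b y \<tau>)
      = affine_defect f (in_coords A F c) (in_coords B F' d) (x \<tau>) (velocity a b x \<tau>) (velocity a b x \<tau>) (velocity a b x \<tau>)"
proof -
  note ap = k[unfolded autoparallel_iff[OF fin]]
  have ab: "a < b" and kc: "continuous_map (top_of_set {a..b}) X k" using ap by auto
  from relatively_open_preimage[OF kc openin_rep_dom_preimage[OF smooth charts(1)[OF c] charts(2)[OF d]]]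
  obtain T where T: "open T" "\<And>\<sigma>. \<sigma> \<in> {a..b} \<Longrightarrow> \<sigma> \<in> T \<longleftrightarrow> k \<sigma> \<in> domain c \<inter> \<phi> -` domain d" by blast
  interpret finsler_local_map "coord c ` domain c" "in_coords A F c" "coord d ` domain d" "in_coords B F' d" f "rep_dom c d \<phi>"
    unfolding f_def by (rule local_map[OF c d])
  have reg: "regular_at a b T x"
    by (rule regular_at_union) (use ap c T in \<open>auto simp: x_def\<close>)
  have xy: "x \<sigma> \<in> rep_dom c d \<phi> \<and> y \<sigma> = f (x \<sigma>)" if "\<sigma> \<in> T \<inter> {a..b}" for \<sigma>
    using that T(2)[of \<sigma>] local_rep_coord[OF charts(1)[OF c], of "k \<sigma>" d \<phi>] by (auto simp: x_def y_def f_def)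
  have \<tau>T: "\<tau> \<in> T \<inter> {a..b}" using T \<tau> by auto
  note vi = velocity_image[OF ab T(1) reg open_S smooth_f xy]
  show "regular_at a b {\<tau>} y" by (rule regular_at_point[OF vi(1) \<tau>T])
  show vn: "velocity a b x \<tau> \<noteq> 0" using ap c \<tau> by (auto simp: x_def)
  show v: "velocity a b y \<tau> = D f (x \<tau>) (velocity a b x \<tau>)" by (rule vi(2)[OF _ \<tau>T])
  have t: "x \<tau> \<in> rep_dom c d \<phi>" using xy[OF \<tau>T] by blast
  have "velocity a b (velocity a b x) \<tau> = - 2 *\<^sub>R spray_vec (in_coords A F c) (x \<tau>, velocity a b x \<tau>)"
    using ap c \<tau> by (auto simp: x_def)
  moreover have "velocity a b (velocity a b y) \<tau> =
      D2 f (x \<tau>) (velocity a b x \<tau>) (velocity a b x \<tau>) + D f (x \<tau>) (velocity a b (velocity a b x) \<tau>)"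
    by (rule vi(3)[OF _ \<tau>T])
  ultimately show "velocity a b (velocity a b y) \<tau> + 2 *\<^sub>R spray_vec (in_coords B F' d) (y \<tau>, velocity a b y \<tau>)
      = affine_defect f (in_coords A F c) (in_coords B F' d) (x \<tau>) (velocity a b x \<tau>) (velocity a b x \<tau>) (velocity a b x \<tau>)"
    unfolding affine_defect_diagonal[OF t vn] v
    using xy[OF \<tau>T] linear_cmul[OF linear_Df[OF t], of "-2"] by (simp add: linear_cmul[OF linear_Df[OF t]] linear_neg[OF linear_Df[OF t]])
qed

lemma affine_map_preserves_autoparallel:
  assumes aff: "affine_map A F B F' \<phi>" and k: "autoparallel X A F a b k"
  shows "autoparallel Y B F' a b (\<phi> \<circ> k)"
  unfolding autoparallel_iff[OF fin']
proof (intro conjI ballI impI)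
  note ap = k[unfolded autoparallel_iff[OF fin]]
  show "a < b" using ap by blast
  have kc: "continuous_map (top_of_set {a..b}) X k" using ap by auto
  then show "continuous_map (top_of_set {a..b}) Y (\<phi> \<circ> k)"
    using smooth by (auto simp: smooth_map_def intro: continuous_map_compose)
  fix d \<tau> assume d: "d \<in> B" and \<tau>: "\<tau> \<in> {a..b}" "(\<phi> \<circ> k) \<tau> \<in> domain d"
  have "k \<tau> \<in> topspace X" using kc \<tau> by (auto simp: continuous_map_def Pi_iff)
  then obtain c where c: "c \<in> A" "k \<tau> \<in> domain c" using smooth_manifold_cover[OF manifold(1)] by blast
  note vl = velocity_local_rep[OF k c(1) d \<tau>(1) c(2)]
  have pd: "\<phi> (k \<tau>) \<in> domain d" using \<tau> by simp
  have t: "(coord c \<circ> k) \<tau> \<in> rep_dom c d \<phi>" using c \<tau> by auto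
  show "regular_at a b {\<tau>} (coord d \<circ> (\<phi> \<circ> k))" by (rule vl(1)[OF pd])
  \<comment> \<open>An autoparallel curve must have nonzero velocity; injectivity of the
    differential preserves this.\<close>
  show "velocity a b (coord d \<circ> (\<phi> \<circ> k)) \<tau> \<noteq> 0"
    using finsler_local_map.inj_D[OF local_map[OF c(1) d] t vl(2)[OF pd]] vl(3)[OF pd] by simp
  have "affine_defect (local_rep c d \<phi>) (in_coords A F c) (in_coords B F' d) ((coord c \<circ> k) \<tau>)
      (velocity a b (coord c \<circ> k) \<tau>) (velocity a b (coord c \<circ> k) \<tau>) (velocity a b (coord c \<circ> k) \<tau>) = 0"
    using aff c(1) d t vl(2)[OF pd] unfolding affine_map_iff by blast
  then show "velocity a b (velocity a b (coord d \<circ> (\<phi> \<circ> k))) \<tau> =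
      - 2 *\<^sub>R spray_vec (in_coords B F' d) (coord d ((\<phi> \<circ> k) \<tau>), velocity a b (coord d \<circ> (\<phi> \<circ> k)) \<tau>)"
    using vl(4)[OF pd] by (simp add: add_eq_0_iff2)
qed

text \<open>For each nonzero \<open>s\<close> at \<open>t\<close>, one autoparallel curve starting
  there with velocity \<open>s\<close> suffices: the equation of its image at parameter 0 is the
  vanishing of the diagonal defect at \<open>(t, s)\<close>.\<close>

lemma preserves_autoparallel_affine_map:
  assumes pres: "\<And>a b k. autoparallel X A F a b k \<Longrightarrow> autoparallel Y B F' a b (\<phi> \<circ> k)"
  shows "affine_map A F B F' \<phi>"
  unfolding affine_map_iff
proof (intro ballI allI impI)
  fix c d t and s :: "real ^ 'p"
  assume c: "c \<in> A" and d: "d \<in> B" and t: "t \<in> rep_dom c d \<phi>" and s: "s \<noteq> 0"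
  have tU: "t \<in> coord c ` domain c" using t by auto
  obtain b k where b: "0 < b" and k: "autoparallel X A F 0 b k" "k 0 = point_of c t"
    "velocity 0 b (coord c \<circ> k) 0 = s"
    by (rule exists_autoparallel[OF fin c tU s])
  have kd: "k 0 \<in> domain c" "\<phi> (k 0) \<in> domain d" "coord c (k 0) = t"
    using t point_of_coord[OF charts(1)[OF c]] by (auto simp: k(2))
  have z: "0 \<in> {0..b}" using b by simp
  note vl = velocity_local_rep(4)[OF k(1) c d z kd(1,2)]
  have "velocity 0 b (velocity 0 b (coord d \<circ> (\<phi> \<circ> k))) 0 =
      - 2 *\<^sub>R spray_vec (in_coords B F' d) (coord d ((\<phi> \<circ> k) 0), velocity 0 b (coord d \<circ> (\<phi> \<circ> k)) 0)"
    using pres[OF k(1)] d z kd(2) unfolding autoparallel_iff[OF fin'] by simp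
  then show "affine_defect (local_rep c d \<phi>) (in_coords A F c) (in_coords B F' d) t s s s = 0"
    using vl kd(3) k(3) by simp
qed

end

theorem theorem4p3:
  fixes X :: "'a topology" and A :: "('a, 'p::finite) chart set"
    and F :: "'a \<Rightarrow> ('a, 'p) tvec \<Rightarrow> real"
    and Y :: "'b topology" and B :: "('b, 'n::finite) chart set"
    and F' :: "'b \<Rightarrow> ('b, 'n) tvec \<Rightarrow> real"
    and \<phi> :: "'a \<Rightarrow> 'b"
  assumes "finsler_manifold X A F"
    and "finsler_manifold Y B F'"
    and "smooth_map X A Y B \<phi>"
    and "nondegenerate X A B \<phi>"
  shows "affine_map A F B F' \<phi> \<longleftrightarrow>
    (\<forall>a b k. autoparallel X A F a b k \<longrightarrow> autoparallel Y B F' a b (\<phi> \<circ> k))"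
proof -
  interpret finsler_map X A F Y B F' \<phi> using assms by unfold_locales
  show ?thesis
    using affine_map_preserves_autoparallel preserves_autoparallel_affine_map by blast
qed

end
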